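(* Let $n\ge0$, $C_0,\ldots,C_n\in\mathcal{P}(\mathbb{R}^d)$, $M_0,\ldots,M_n\in\hat{\mathscr{B}}(\mathbb{R}^d)$, $T_0,\ldots,T_n\in\mathrm{GL}_d$. Then for $Q_0,\ldots,Q_n\in O(d)$ independent and uniformly at random and $k>0$ (an integer, $k\le d$), $$\mathbb{E}\bigg[ \Psi_k\bigg( \bigcap_{i=0}^n T_i Q_i C_i ,\ \bigcap_{i=0}^n T_i Q_i M_i\bigg)\bigg] = \Psi_{nd+k}(C,M),$$ where $C:=C_0\times\cdots\times C_n$, $M:=M_0\times \cdots\times M_n$, and where the polyhedral measures of the product are given by $$\Psi_m(C,M) = \sum_{i_0+\cdots+i_n=m} \Psi_{i_0}(C_0,M_0)\cdots \Psi_{i_n}(C_n,M_n).$$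
   Context: A polyhedral cone in $\mathbb{R}^d$ is a set of the form $\{x\in\mathbb{R}^d : Ax\le 0\}$ for some real matrix $A$ with $d$ columns; $\mathcal{P}(\mathbb{R}^d)$ is the set of polyhedral cones in $\mathbb{R}^d$. A face of $C$ is a subset $\{x\in C: \langle x,z\rangle=0\}$, where $z\in\mathbb{R}^d$ satisfies $\langle x,z\rangle\le 0$ for all $x\in C$. $\mathcal{L}_k(C)$ is the finite set of linear spans of faces of $C$ whose span has dimension $k$. $\hat{\mathscr{B}}(\mathbb{R}^d)$ is the conic $\sigma$-algebra: the Borel sets $M\subseteq\mathbb{R}^d$ with $\lambda M=M$ for all $\lambda>0$. $\gamma_L$ is the standard Gaussian measure on a linear subspace $L$ (the Dirac measure at the origin if $\dim L=0$). The polyhedral measures are $\Psi_k(C,M)=\sum_{L\in\mathcal{L}_k(C)}\gamma_L(C\cap L\cap M)$. The product $C_0\times\cdots\times C_n$ is a polyhedral cone in $\mathbb{R}^{(n+1)d}$ and $M_0\times\cdots\times M_n\in\hat{\mathscr{B}}(\mathbb{R}^{(n+1)d})$ if one only requires invariance under simultaneous positive scaling. "Uniformly at random" in $O(d)$ means distributed according to the normalized Haar measure. *)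

theory Defs
  imports "HOL-Probability.Probability"
begin

(* The finite set A is the set of rows of the matrix; the empty set gives the whole space. *)
definition polyhedral_cone :: "'a::euclidean_space set \<Rightarrow> bool" where
  "polyhedral_cone C \<longleftrightarrow> (\<exists>A. finite A \<and> C = {x. \<forall>a\<in>A. a \<bullet> x \<le> 0})"

(* The supporting hyperplane passes through the origin, so unlike for face_of and exposed_face_of
   the empty set is not a face of a cone. *)
definition cone_face :: "'a::euclidean_space set \<Rightarrow> 'a set \<Rightarrow> bool" where
  "cone_face F C \<longleftrightarrow> (\<exists>z. (\<forall>x\<in>C. x \<bullet> z \<le> 0) \<and> F = {x \<in> C. x \<bullet> z = 0})"

definition face_spans :: "nat \<Rightarrow> 'a::euclidean_space set \<Rightarrow> 'a set set" where
  "face_spans k C = {L. \<exists>F. cone_face F C \<and> L = span F \<and> dim L = k}"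

definition conic_borel :: "'a::euclidean_space set set" where
  "conic_borel = {M \<in> sets borel. \<forall>c>0. (\<lambda>x. c *\<^sub>R x) ` M = M}"

definition orthonormal_basis_of :: "'a::euclidean_space set \<Rightarrow> 'a set \<Rightarrow> bool" where
  "orthonormal_basis_of B L \<longleftrightarrow>
     pairwise orthogonal B \<and> (\<forall>b\<in>B. norm b = 1) \<and> span B = L"

(* The law of the sum of g_b b over an orthonormal basis of L, with independent standard normal
   coordinates g_b. By rotation invariance it does not depend on the basis chosen. It is a measure
   on the ambient space, concentrated on the subspace L. *)
definition gaussian_on :: "'a::euclidean_space set \<Rightarrow> 'a measure" where
  "gaussian_on L =
     (let B = (SOME B. orthonormal_basis_of B L) in
      distr (PiM B (\<lambda>_. density lborel std_normal_density)) borel (\<lambda>g. \<Sum>b\<in>B. g b *\<^sub>R b))"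

lemma gaussian_on_0: "gaussian_on {0 :: 'a::euclidean_space} = return borel 0"
proof -
  have "B = {}" if "orthonormal_basis_of B {0::'a}" for B
    using that span_superset[of B] by (force simp: orthonormal_basis_of_def)
  moreover have "orthonormal_basis_of {} {0::'a}"
    by (simp add: orthonormal_basis_of_def)
  ultimately have B: "(SOME B. orthonormal_basis_of B {0::'a}) = {}"
    by (metis (mono_tags) someI)
  show ?thesis
    unfolding gaussian_on_def B
    by (simp add: PiM_empty Let_def)
       (rule measure_eqI; simp add: emeasure_distr emeasure_count_space indicator_def)
qed

definition polyhedral_measure :: "nat \<Rightarrow> 'a::euclidean_space set \<Rightarrow> 'a set \<Rightarrow> real" where
  "polyhedral_measure k C M = (\<Sum>L\<in>face_spans k C. measure (gaussian_on L) (C \<inter> L \<inter> M))"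

definition set_product :: "('i::finite \<Rightarrow> 'a set) \<Rightarrow> ('a ^ 'i) set" where
  "set_product X = {x. \<forall>i. x $ i \<in> X i}"

definition orthogonal_borel :: "(real ^ 'd ^ 'd) measure" where
  "orthogonal_borel = restrict_space borel {Q. orthogonal_matrix Q}"

(* These conditions determine the measure uniquely, and they imply right invariance. *)
definition haar_orthogonal :: "(real ^ 'd ^ 'd) measure \<Rightarrow> bool" where
  "haar_orthogonal \<mu> \<longleftrightarrow>
     prob_space \<mu> \<and> sets \<mu> = sets orthogonal_borel \<and>
     (\<forall>U. orthogonal_matrix U \<longrightarrow> distr \<mu> \<mu> (\<lambda>Q. U ** Q) = \<mu>)"

end

theory Submission
  imports Defs
begin

text \<open>
To a point \<open>x\<close> of a polyhedral cone \<open>D\<close> attach the subspace \<open>lineality D x\<close> of those directions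
in which one can move from \<open>x\<close> a little in both senses inside \<open>D\<close>. It is the span of the smallest
face containing \<open>x\<close>, so the spans of faces are exactly these subspaces, and \<open>D\<close> is the disjoint
union of finitely many strata on which \<open>lineality D\<close> is constant. The stratum of \<open>L\<close> differs from
\<open>D \<inter> L\<close> by a Gaussian null set of \<open>L\<close>. Lineality spaces are compatible with linear preimages and
intersections; for the cone of all \<open>x\<close> with \<open>f i x \<in> C i\<close> for all \<open>i\<close>, where the \<open>f i\<close> are linear,
the polyhedral measure is therefore a sum over tuples \<open>L\<close> of spans of faces of the \<open>C i\<close>, one for
each \<open>i\<close> (\<open>polyhedral_measure_vimage\<close>). This is an exact identity, valid for every position of the
cones, and it is applied twice: to the intersection of the \<open>T i (Q i (C i))\<close>, where \<open>f i\<close> is the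
inverse of \<open>T i\<close> composed with \<open>Q i\<close>, and to the product of the \<open>C i\<close>, where \<open>f i\<close> is a coordinate
projection. The sums match term by term once the following two facts are known for a tuple \<open>L\<close> of
subspaces and the intersection \<open>K\<close> of the \<open>T i (Q i (L i))\<close>.

First, \<open>K\<close> almost surely has dimension \<open>\<Sum> dim (L i) - n d\<close>, or \<open>0\<close> if this is negative
(\<open>AE_dim_meet\<close>). Since \<open>k > 0\<close>, the tuples with \<open>dim K = k\<close> are almost surely those whose dimensions
add up to \<open>n d + k\<close>.

Second, for conic Borel sets \<open>A i\<close> and such a tuple, the mean of the Gaussian measure on \<open>K\<close> of the
intersection of the \<open>T i (Q i (A i))\<close> is the Gaussian measure of the product of the \<open>A i\<close> on the
product of the \<open>L i\<close> (\<open>average_gaussian_meet\<close>). To see this, draw a Gaussian point of \<open>K\<close> and consider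
the directions of the vectors in \<open>L i\<close> that are mapped to this point. Composing \<open>Q i\<close> from the right
with a reflection that preserves \<open>L i\<close> changes neither its law nor \<open>K\<close>, and it reflects the direction
in \<open>L i\<close>. So the joint law of the directions is invariant under independent reflections of the \<open>L i\<close>.
These act transitively on the product of the unit spheres, so all balls of a given radius with centre
in this product have the same mass, and only one probability measure has this property
(\<open>measure_eq_of_uniform_balls\<close>). The directions of the components of a Gaussian vector in the
product of the \<open>L i\<close> have a law of this kind as well. The maps \<open>T i\<close> influence the distribution of
the lengths, but not that of the directions, and membership in a conic set depends on the direction
only; this is why the value of the mean does not involve the \<open>T i\<close>.

The product formula holds because the Gaussian measure on a product of subspaces is the product of
the Gaussian measures (\<open>measure_gaussian_on_set_product\<close>). All expectations make sense because
\<open>gaussian_on K\<close> is the image of one fixed Gaussian measure under the orthogonal projection onto \<open>K\<close>,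
and this projection is a limit of solutions of linear systems whose coefficients are polynomials
in the entries of the rotations (\<open>measurable_oproj_vimage\<close>).
\<close>

section \<open>Rotation invariance of Lebesgue measure and of the standard Gaussian measure\<close>

text \<open>The image measure \<open>\<mu>\<close> is again translation invariant. For translation invariant measures \<open>\<mu>\<close> and
\<open>\<lambda>\<close>, where \<open>\<lambda>\<close> is also invariant under point reflections, integrating the indicator of the pairs
\<open>(x, y)\<close> with \<open>x \<in> A\<close> and \<open>x + y \<in> E\<close> in both orders gives \<open>\<mu> A * \<lambda> E = \<mu> E * \<lambda> A\<close>. For \<open>E\<close> take the
unit ball, which has the same mass under \<open>\<mu>\<close> and \<open>\<lambda>\<close> because \<open>f\<close> preserves it.\<close>

lemma distr_lborel_orthogonal_transformation:
  fixes f :: "'a::euclidean_space \<Rightarrow> 'a"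
  assumes f: "orthogonal_transformation f"
  shows "distr lborel borel f = lborel"
proof (rule measure_eqI)
  have lin: "linear f" using f by (rule orthogonal_transformation_linear)
  have [measurable]: "f \<in> borel_measurable borel"
    using lin by (simp add: borel_measurable_continuous_onI linear_continuous_on linear_conv_bounded_linear)
  let ?\<mu> = "distr lborel borel f"
  have sf: "sigma_finite_measure ?\<mu>"
  proof (rule sigma_finite_measure.intro, intro exI conjI)
    let ?A = "range (\<lambda>n::nat. ball (0::'a) n)"
    show "countable ?A" "?A \<subseteq> sets ?\<mu>" by auto
    show "\<Union>?A = space ?\<mu>"
      by (auto simp: reals_Archimedean2)
    have vb: "f -` ball 0 r = ball 0 r" for r
      using orthogonal_transformation_norm[OF f] by auto
    show "\<forall>a\<in>?A. emeasure ?\<mu> a \<noteq> \<infinity>"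
      using emeasure_lborel_ball_finite[of "0::'a"] by (auto simp: emeasure_distr vb less_top)
  qed
  interpret P: pair_sigma_finite lborel ?\<mu>
    using sf by (simp add: pair_sigma_finite_def lborel.sigma_finite_measure_axioms)
  show "sets ?\<mu> = sets lborel" by simp
  have trans: "distr ?\<mu> borel ((+) c) = ?\<mu>" for c
  proof -
    obtain c' where c': "c = f c'" using orthogonal_transformation_surj[OF f] by (metis surjD)
    have "distr ?\<mu> borel ((+) c) = distr (distr lborel borel ((+) c')) borel f"
      by (simp add: distr_distr o_def c' linear_add[OF lin])
    then show ?thesis by (simp add: lborel_distr_plus)
  qed
  \<comment> \<open>Lebesgue measure is invariant under the point reflection that sends y to x - y.\<close>
  have refl: "emeasure lborel ((\<lambda>y. x - y) -` A) = emeasure lborel A"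
    if [measurable]: "A \<in> sets borel" for A :: "'a set" and x
  proof -
    have "lborel = density (distr lborel borel (\<lambda>y. x + (-1) *\<^sub>R y)) (\<lambda>_. 1)"
      using lborel_affine[of "-1" x] by simp
    then have *: "lborel = distr lborel borel (\<lambda>y. x - y)" by (simp add: density_1)
    show ?thesis by (subst (2) *) (simp add: emeasure_distr)
  qed
  have eq: "emeasure ?\<mu> A * emeasure lborel E = emeasure ?\<mu> E * emeasure lborel A"
    if [measurable]: "A \<in> sets borel" "E \<in> sets borel" for A E
  proof -
    have "emeasure ?\<mu> A * emeasure lborel E
      = (\<integral>\<^sup>+x. \<integral>\<^sup>+y. indicator A x * indicator E (x + y) \<partial>lborel \<partial>?\<mu>)"
    proof -
      have "(\<integral>\<^sup>+y. indicator A x * indicator E (x + y) \<partial>lborel) = indicator A x * emeasure lborel E" for x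
      proof -
        have "(\<integral>\<^sup>+y. indicator E (x + y) \<partial>lborel) = (\<integral>\<^sup>+y. indicator E y \<partial>distr lborel borel ((+) x))"
          by (simp add: nn_integral_distr del: nn_integral_indicator)
        then have "(\<integral>\<^sup>+y. indicator E (x + y) \<partial>lborel) = emeasure lborel E"
          by (simp add: lborel_distr_plus)
        then show ?thesis by (simp add: nn_integral_cmult)
      qed
      then show ?thesis by (simp add: nn_integral_multc)
    qed
    also have "\<dots> = (\<integral>\<^sup>+y. \<integral>\<^sup>+x. indicator A x * indicator E (x + y) \<partial>?\<mu> \<partial>lborel)"
      by (rule P.Fubini') simp
    also have "\<dots> = (\<integral>\<^sup>+y. \<integral>\<^sup>+x. indicator A (x - y) * indicator E x \<partial>?\<mu> \<partial>lborel)"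
    proof (rule nn_integral_cong)
      fix y
      have "(\<integral>\<^sup>+x. indicator A (x - y) * indicator E x \<partial>?\<mu>)
          = (\<integral>\<^sup>+x. indicator A (x - y) * indicator E x \<partial>distr ?\<mu> borel ((+) y))" by (simp add: trans)
      also have "\<dots> = (\<integral>\<^sup>+x. indicator A x * indicator E (x + y) \<partial>?\<mu>)"
        by (subst nn_integral_distr) (auto simp: add.commute)
      finally show "(\<integral>\<^sup>+x. indicator A x * indicator E (x + y) \<partial>?\<mu>)
         = (\<integral>\<^sup>+x. indicator A (x - y) * indicator E x \<partial>?\<mu>)" by simp
    qed
    also have "\<dots> = (\<integral>\<^sup>+x. \<integral>\<^sup>+y. indicator A (x - y) * indicator E x \<partial>lborel \<partial>?\<mu>)"
      by (rule P.Fubini'[symmetric]) simp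
    also have "\<dots> = (\<integral>\<^sup>+x. emeasure lborel A * indicator E x \<partial>?\<mu>)"
    proof (rule nn_integral_cong)
      fix x
      have "(\<integral>\<^sup>+y. indicator A (x - y) \<partial>lborel) = (\<integral>\<^sup>+y. indicator ((\<lambda>y. x - y) -` A) y \<partial>lborel)"
        by (intro nn_integral_cong) (auto simp: indicator_def)
      also have "\<dots> = emeasure lborel A" by (subst nn_integral_indicator) (auto simp: refl intro: measurable_sets_borel[where M=borel])
      finally show "(\<integral>\<^sup>+y. indicator A (x - y) * indicator E x \<partial>lborel) = emeasure lborel A * indicator E x"
        by (simp add: nn_integral_multc)
    qed
    also have "\<dots> = emeasure ?\<mu> E * emeasure lborel A"
      by (subst nn_integral_cmult) (auto simp: mult.commute)
    finally show ?thesis .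
  qed
  fix A assume "A \<in> sets ?\<mu>"
  then have A: "A \<in> sets borel" by simp
  let ?b = "ball (0::'a) 1"
  have "f -` ?b = ?b" using orthogonal_transformation_norm[OF f] by auto
  then have "emeasure ?\<mu> ?b = emeasure lborel ?b" by (simp add: emeasure_distr)
  then have "emeasure lborel ?b * emeasure ?\<mu> A = emeasure lborel ?b * emeasure lborel A"
    using eq[OF A, of ?b] by (simp add: mult.commute)
  moreover have "emeasure lborel ?b \<noteq> \<infinity>" "emeasure lborel ?b \<noteq> 0"
    using emeasure_lborel_ball_finite[of "0::'a" 1] open_not_negligible[of ?b]
    by (auto simp: less_top negligible_iff_emeasure0)
  ultimately show "emeasure ?\<mu> A = emeasure lborel A"
    by (simp add: ennreal_mult_cancel_left)
qed

abbreviation std_normal :: "real measure" where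
  "std_normal \<equiv> density lborel (\<lambda>x. ennreal (std_normal_density x))"

text \<open>Given by its coordinates in the standard basis, the same form that \<open>gaussian_on\<close> has, so that laws
of coordinates can be read off directly.\<close>

definition std_gauss :: "'a::euclidean_space measure" where
  "std_gauss = distr (PiM Basis (\<lambda>_. std_normal)) borel (\<lambda>g. \<Sum>b\<in>Basis. g b *\<^sub>R b)"

lemma prob_space_std_normal: "prob_space std_normal"
  by (rule prob_space_normal_density) simp

interpretation std_normal: prob_space std_normal
  by (rule prob_space_std_normal)

interpretation std_normals: product_prob_space "\<lambda>_. std_normal" I for I
  by (rule product_prob_spaceI) (rule prob_space_std_normal)

lemma sets_std_gauss [measurable_cong, simp]: "sets std_gauss = sets borel"
  by (simp add: std_gauss_def)

lemma space_std_gauss [simp]: "space std_gauss = UNIV"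
  by (simp add: std_gauss_def)

lemma prob_space_std_gauss: "prob_space (std_gauss :: 'a::euclidean_space measure)"
  unfolding std_gauss_def
  by (rule prob_space.prob_space_distr) (auto intro: prob_space_PiM prob_space_std_normal)

interpretation std_gauss: prob_space std_gauss
  by (rule prob_space_std_gauss)

text \<open>Since this density depends on the norm only, the measure is rotation invariant.\<close>

lemma std_gauss_density:
  "(std_gauss :: 'a::euclidean_space measure)
     = density lborel (\<lambda>x. ennreal ((1 / sqrt (2 * pi)) ^ DIM('a) * exp (- (norm x)\<^sup>2 / 2)))"
proof -
  let ?L = "PiM Basis (\<lambda>_::'a. lborel :: real measure)"
  let ?h = "\<lambda>g. \<Prod>b\<in>(Basis::'a set). ennreal (std_normal_density (g b))"
  let ?T = "\<lambda>g. \<Sum>b\<in>(Basis::'a set). g b *\<^sub>R b"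
  interpret lb: product_sigma_finite "\<lambda>_::'a. lborel :: real measure" by standard
  have PiM: "density ?L ?h = PiM Basis (\<lambda>_. std_normal)"
  proof (rule std_normals.PiM_eqI)
    show "sets (density ?L ?h) = sets (PiM Basis (\<lambda>_::'a. std_normal))"
      by (simp cong: sets_PiM_cong)
    fix A :: "'a \<Rightarrow> real set" assume A: "\<And>i. i \<in> Basis \<Longrightarrow> A i \<in> sets std_normal"
    have [measurable]: "PiE Basis A \<in> sets ?L"
      using A by (intro sets_PiM_I_finite) auto
    have "emeasure (density ?L ?h) (PiE Basis A)
       = (\<integral>\<^sup>+g. ?h g * indicator (PiE Basis A) g \<partial>?L)"
      by (subst emeasure_density) auto
    also have "\<dots> = (\<integral>\<^sup>+g. (\<Prod>b\<in>Basis. ennreal (std_normal_density (g b)) * indicator (A b) (g b)) \<partial>?L)"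
    proof (rule nn_integral_cong)
      fix g assume "g \<in> space ?L"
      then have ext: "g \<in> extensional Basis" by (simp add: space_PiM PiE_def)
      have "indicator (PiE Basis A) g = (\<Prod>b\<in>Basis. indicator (A b) (g b) :: ennreal)"
      proof (cases "\<forall>b\<in>Basis. g b \<in> A b")
        case True
        then show ?thesis using ext by (simp add: PiE_iff)
      next
        case False
        then obtain b where "b \<in> Basis" "g b \<notin> A b" by blast
        then show ?thesis by (subst prod_zero) (auto intro!: bexI[of _ b] simp: PiE_iff indicator_def)
      qed
      then show "?h g * indicator (PiE Basis A) g
         = (\<Prod>b\<in>Basis. ennreal (std_normal_density (g b)) * indicator (A b) (g b))"
        by (simp add: prod.distrib)
    qed
    also have "\<dots> = (\<Prod>b\<in>Basis. (\<integral>\<^sup>+x. ennreal (std_normal_density x) * indicator (A b) x \<partial>lborel))"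
      using A by (intro lb.product_nn_integral_prod) auto
    also have "\<dots> = (\<Prod>b\<in>Basis. emeasure std_normal (A b))"
      using A by (intro prod.cong refl) (simp add: emeasure_density)
    finally show "emeasure (density ?L ?h) (PiE Basis A) = (\<Prod>b\<in>Basis. emeasure std_normal (A b))" .
  qed simp
  have lborel: "lborel = distr ?L borel ?T"
    unfolding lborel_eq_real by (rule lborel_def)
  have h: "?h (\<lambda>b. x \<bullet> b) = ennreal ((1 / sqrt (2 * pi)) ^ DIM('a) * exp (- (norm x)\<^sup>2 / 2))" for x :: 'a
  proof -
    have "(\<Prod>b\<in>(Basis::'a set). std_normal_density (x \<bullet> b))
      = (1 / sqrt (2 * pi)) ^ DIM('a) * exp (\<Sum>b\<in>(Basis::'a set). - (x \<bullet> b)\<^sup>2 / 2)"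
      by (simp add: std_normal_density_def prod.distrib prod_dividef exp_sum power_divide)
    also have "(\<Sum>b\<in>(Basis::'a set). - (x \<bullet> b)\<^sup>2 / 2) = - (norm x)\<^sup>2 / 2"
      by (simp add: norm_eq_sqrt_inner euclidean_inner[of x x] sum_negf sum_divide_distrib power2_eq_square
          sum_nonneg)
    finally show ?thesis by (simp add: prod_ennreal)
  qed
  have T: "?T g \<bullet> b = g b" if "b \<in> Basis" for g and b :: 'a
    using that by simp
  have "distr (density ?L (\<lambda>g. ?h (\<lambda>b. ?T g \<bullet> b))) borel ?T = density (distr ?L borel ?T) (\<lambda>x. ?h (\<lambda>b. x \<bullet> b))"
    by (subst density_distr) auto
  moreover have "density ?L (\<lambda>g. ?h (\<lambda>b. ?T g \<bullet> b)) = density ?L ?h"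
    by (intro density_cong) (auto simp: T intro!: prod.cong)
  ultimately show ?thesis
    unfolding h std_gauss_def PiM[symmetric] lborel[symmetric] by simp
qed

lemma borel_measurable_linear: "linear f \<Longrightarrow> f \<in> borel_measurable borel"
  for f :: "'a::euclidean_space \<Rightarrow> 'b::real_normed_vector"
  by (simp add: borel_measurable_continuous_onI linear_continuous_on linear_conv_bounded_linear)

lemma distr_std_gauss_orthogonal_transformation:
  fixes f :: "'a::euclidean_space \<Rightarrow> 'a"
  assumes f: "orthogonal_transformation f"
  shows "distr std_gauss borel f = std_gauss"
proof -
  have [measurable]: "f \<in> borel_measurable borel"
    using f by (intro borel_measurable_linear orthogonal_transformation_linear)
  define h where "h x = ennreal ((1 / sqrt (2 * pi)) ^ DIM('a) * exp (- (norm x)\<^sup>2 / 2))" for x :: 'a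
  have [measurable]: "h \<in> borel_measurable borel" unfolding h_def by measurable
  have hf: "h (f x) = h x" for x by (simp add: h_def orthogonal_transformation_norm[OF f])
  have "distr (density lborel (\<lambda>x. h (f x))) borel f = density (distr lborel borel f) h"
    by (subst density_distr) auto
  then show ?thesis
    unfolding std_gauss_density h_def[symmetric] hf distr_lborel_orthogonal_transformation[OF f] .
qed

lemma AE_std_gauss_hyperplane:
  assumes "a \<noteq> 0"
  shows "AE x in std_gauss. a \<bullet> x \<noteq> 0"
proof -
  have "AE x in lborel. a \<bullet> x \<noteq> 0"
  proof -
    have "{x. a \<bullet> x = 0} \<in> null_sets lborel"
      using negligible_hyperplane[of a 0] assms
      by (auto simp: negligible_iff_null_sets null_sets_completion_iff closed_hyperplane)
    then show ?thesis by (rule AE_I') auto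
  qed
  then show ?thesis unfolding std_gauss_density by (subst AE_density) auto
qed

lemma finite_orthonormal_family:
  fixes u :: "'j \<Rightarrow> 'a::euclidean_space"
  assumes u: "\<And>i j. i \<in> J \<Longrightarrow> j \<in> J \<Longrightarrow> u i \<bullet> u j = (if i = j then 1 else 0)"
  shows "inj_on u J" "finite J"
proof -
  show inj: "inj_on u J" using u by (intro inj_onI) (metis zero_neq_one)
  have "pairwise orthogonal (u ` J)" "0 \<notin> u ` J"
    using u by (auto simp: pairwise_def orthogonal_def) (metis inner_zero_left zero_neq_one)
  then have "finite (u ` J)" by (intro independent_imp_finite pairwise_orthogonal_independent)
  then show "finite J" using inj by (rule finite_imageD)
qed

text \<open>Complete the family to an orthonormal basis of the whole space and match that basis with the
standard one. In this way statements about orthonormal families reduce, by rotation invariance, to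
subfamilies of the standard basis.\<close>

lemma orthonormal_family_extend:
  fixes u :: "'j \<Rightarrow> 'a::euclidean_space"
  assumes u: "\<And>i j. i \<in> J \<Longrightarrow> j \<in> J \<Longrightarrow> u i \<bullet> u j = (if i = j then 1 else 0)"
  obtains f :: "'a \<Rightarrow> 'a" and e where "orthogonal_transformation f" "inj_on e J" "e ` J \<subseteq> Basis" "\<And>j. j \<in> J \<Longrightarrow> u j = f (e j)"
proof -
  define B where "B = u ` J"
  have inj: "inj_on u J" and finJ: "finite J" using finite_orthonormal_family[of J u] u by blast+
  have B: "pairwise orthogonal B" "\<And>b. b \<in> B \<Longrightarrow> b \<bullet> b = 1"
    using u by (auto simp: B_def pairwise_def orthogonal_def)
  then have "0 \<notin> B" by force
  then have indB: "independent B" using B(1) by (intro pairwise_orthogonal_independent)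
  have fB: "finite B" using finJ by (simp add: B_def)
  obtain C where C: "C \<subseteq> {y. \<forall>x\<in>span B. orthogonal x y}" "pairwise orthogonal C" "\<And>x. x \<in> C \<Longrightarrow> norm x = 1"
    "independent C" "card C = dim {y. \<forall>x\<in>span B. orthogonal x y}"
    by (rule orthonormal_basis_subspace[OF subspace_orthogonal_to_vectors[of "span B"]]) (rule that; blast)
  have fC: "finite C" using C(4) independent_imp_finite by blast
  have orth: "orthogonal b c" "orthogonal c b" if "b \<in> B" "c \<in> C" for b c
    using C(1) that span_base orthogonal_commute by blast+
  have disj: "B \<inter> C = {}"
    using orth B(2) by (force simp: orthogonal_def)
  have "card C + dim (span B) = DIM('a)"
    using dim_subspace_orthogonal_to_vectors[of "span B" UNIV] C(5) by simp
  moreover have "dim (span B) = card B" using indB by (simp add: dim_eq_card_independent)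
  ultimately have "card (B \<union> C) = card (Basis::'a set)" by (simp add: card_Un_disjoint fB fC disj)
  then obtain h where h: "bij_betw h (Basis::'a set) (B \<union> C)"
    using finite_same_card_bij[of "Basis::'a set" "B \<union> C"] fB fC by auto
  have hh: "h e \<bullet> h e' = (if e = e' then 1 else 0)" if "e \<in> Basis" "e' \<in> Basis" for e e'
  proof -
    have BC: "x \<bullet> y = (if x = y then 1 else 0)" if "x \<in> B \<union> C" "y \<in> B \<union> C" for x y
      using that B C(2,3) orth disj
      by (auto simp: pairwise_def orthogonal_def norm_eq_1)
    have "h e = h e' \<longleftrightarrow> e = e'" using h that by (meson bij_betw_def inj_on_eq_iff)
    moreover have "h e \<in> B \<union> C" "h e' \<in> B \<union> C" using h that bij_betwE by blast+
    ultimately show ?thesis using BC by simp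
  qed
  define f where "f v = (\<Sum>e\<in>Basis. (v \<bullet> e) *\<^sub>R h e)" for v
  have "linear f"
    by (rule linearI) (simp_all add: f_def inner_simps algebra_simps sum.distrib scaleR_sum_right)
  moreover have "f v \<bullet> f w = v \<bullet> w" for v w
  proof -
    have "f v \<bullet> f w = (\<Sum>e\<in>Basis. \<Sum>e'\<in>Basis. (v \<bullet> e) * ((w \<bullet> e') * (h e \<bullet> h e')))"
      unfolding f_def inner_sum_left by (simp only: inner_sum_right inner_scaleR_left inner_scaleR_right sum_distrib_left mult_ac)
    also have "\<dots> = (\<Sum>e\<in>Basis. \<Sum>e'\<in>Basis. if e = e' then (v \<bullet> e) * (w \<bullet> e') else 0)"
      by (intro sum.cong refl) (simp add: hh)
    also have "\<dots> = v \<bullet> w" by (simp add: euclidean_inner[of v w])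
    finally show ?thesis .
  qed
  ultimately have f: "orthogonal_transformation f" by (simp add: orthogonal_transformation_def)
  have fe: "f e = h e" if "e \<in> Basis" for e
  proof -
    have "f e = (\<Sum>e'\<in>Basis. if e' = e then h e' else 0)"
      unfolding f_def using that by (intro sum.cong refl) (auto simp: inner_Basis)
    then show ?thesis using that by simp
  qed
  define e where "e j = inv_into Basis h (u j)" for j
  have uB: "u j \<in> h ` Basis" if "j \<in> J" for j using that h by (auto simp: B_def bij_betw_def)
  have e: "e j \<in> Basis" "h (e j) = u j" if "j \<in> J" for j
    unfolding e_def using uB[OF that] by (auto intro: inv_into_into f_inv_into_f)
  show thesis
  proof (rule that[OF f])
    show "inj_on e J" using e(2) inj by (metis inj_on_def)
    show "e ` J \<subseteq> Basis" using e by auto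
    show "u j = f (e j)" if "j \<in> J" for j using e[OF that] fe by simp
  qed
qed

lemma distr_std_gauss_orthonormal_coords:
  fixes u :: "'j \<Rightarrow> 'a::euclidean_space"
  assumes u: "\<And>i j. i \<in> J \<Longrightarrow> j \<in> J \<Longrightarrow> u i \<bullet> u j = (if i = j then 1 else 0)"
  shows "distr std_gauss (PiM J (\<lambda>_. borel)) (\<lambda>x. \<lambda>j\<in>J. x \<bullet> u j) = PiM J (\<lambda>_. std_normal)"
proof -
  obtain f :: "'a \<Rightarrow> 'a" and e where f: "orthogonal_transformation f" and e: "inj_on e J" "e ` J \<subseteq> Basis"
    and uf: "\<And>j. j \<in> J \<Longrightarrow> u j = f (e j)"
    using orthonormal_family_extend[of J u] u by metis
  have [measurable]: "f \<in> borel_measurable borel"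
    using f by (intro borel_measurable_linear orthogonal_transformation_linear)
  have "distr std_gauss (PiM J (\<lambda>_. borel)) (\<lambda>x. \<lambda>j\<in>J. x \<bullet> u j)
      = distr (distr std_gauss borel f) (PiM J (\<lambda>_. borel)) (\<lambda>x. \<lambda>j\<in>J. x \<bullet> u j)"
    by (simp add: distr_std_gauss_orthogonal_transformation[OF f])
  also have "\<dots> = distr std_gauss (PiM J (\<lambda>_. borel)) (\<lambda>x. \<lambda>j\<in>J. f x \<bullet> u j)"
    by (subst distr_distr) (auto simp: o_def)
  also have "(\<lambda>x. \<lambda>j\<in>J. f x \<bullet> u j) = (\<lambda>x. \<lambda>j\<in>J. x \<bullet> e j)"
    using f by (intro ext restrict_ext) (simp add: uf orthogonal_transformation_def)
  also have "distr std_gauss (PiM J (\<lambda>_. borel)) (\<lambda>x. \<lambda>j\<in>J. x \<bullet> e j)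
      = distr (PiM Basis (\<lambda>_. std_normal)) (PiM J (\<lambda>_. borel)) (\<lambda>g. \<lambda>j\<in>J. g (e j))"
    unfolding std_gauss_def
  proof (subst distr_distr)
    show "distr (PiM Basis (\<lambda>_. std_normal)) (PiM J (\<lambda>_. borel)) ((\<lambda>x. \<lambda>j\<in>J. x \<bullet> e j) \<circ> (\<lambda>g. \<Sum>b\<in>Basis. g b *\<^sub>R b))
        = distr (PiM Basis (\<lambda>_. std_normal)) (PiM J (\<lambda>_. borel)) (\<lambda>g. \<lambda>j\<in>J. g (e j))"
      using e(2) by (intro distr_cong refl) (auto simp: restrict_def fun_eq_iff image_subset_iff)
  qed auto
  also have "\<dots> = distr (PiM Basis (\<lambda>_. std_normal)) (PiM J (\<lambda>_. std_normal)) (\<lambda>g. \<lambda>j\<in>J. g (e j))"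
    by (intro distr_cong refl) (auto cong: sets_PiM_cong)
  also have "\<dots> = PiM J (\<lambda>_. std_normal)"
    using distr_PiM_reindex[of Basis "\<lambda>_. std_normal" e J] e prob_space_std_normal by auto
  finally show ?thesis .
qed


section \<open>Gaussian measures on subspaces as images under orthogonal projections\<close>

definition oproj :: "'a::euclidean_space set \<Rightarrow> 'a \<Rightarrow> 'a" where
  "oproj L x = (THE y. y \<in> L \<and> (\<forall>z\<in>L. (x - y) \<bullet> z = 0))"

lemma oproj_eqI:
  assumes L: "subspace L" and y: "y \<in> L" "\<And>z. z \<in> L \<Longrightarrow> (x - y) \<bullet> z = 0"
  shows "oproj L x = y"
  unfolding oproj_def
proof (rule the_equality)
  fix y' assume y': "y' \<in> L \<and> (\<forall>z\<in>L. (x - y') \<bullet> z = 0)"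
  have d: "y' - y \<in> L" using L y y' by (simp add: subspace_diff)
  have "(y' - y) \<bullet> (y' - y) = (x - y) \<bullet> (y' - y) - (x - y') \<bullet> (y' - y)" by (simp add: inner_simps)
  also have "\<dots> = 0" using y(2)[OF d] y' d by simp
  finally show "y' = y" by simp
qed (use y in auto)

lemma
  assumes L: "subspace L"
  shows oproj_mem: "oproj L x \<in> L" and oproj_orthogonal: "z \<in> L \<Longrightarrow> (x - oproj L x) \<bullet> z = 0"
proof -
  have "span L = L" using L by simp
  then obtain y z where yz: "y \<in> L" "\<And>w. w \<in> L \<Longrightarrow> orthogonal z w" "x = y + z"
    using orthogonal_subspace_decomp_exists[of L x] by metis
  have "oproj L x = y"
    by (rule oproj_eqI[OF L yz(1)]) (use yz in \<open>simp add: orthogonal_def\<close>)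
  then show "oproj L x \<in> L" "z \<in> L \<Longrightarrow> (x - oproj L x) \<bullet> z = 0" for z
    using yz by (auto simp: orthogonal_def)
qed

lemma inner_oproj: "subspace L \<Longrightarrow> z \<in> L \<Longrightarrow> z \<bullet> oproj L x = z \<bullet> x"
  using oproj_orthogonal[of L z x] by (simp add: inner_simps inner_commute)

lemma oproj_ident: "subspace L \<Longrightarrow> x \<in> L \<Longrightarrow> oproj L x = x"
  by (rule oproj_eqI) auto

lemma linear_oproj: "subspace L \<Longrightarrow> linear (oproj L)"
proof (rule linearI)
  assume L: "subspace L"
  show "oproj L (x + y) = oproj L x + oproj L y" for x y
    by (rule oproj_eqI[OF L]) (use L in \<open>auto simp: oproj_mem subspace_add inner_simps inner_commute inner_oproj\<close>)
  show "oproj L (c *\<^sub>R x) = c *\<^sub>R oproj L x" for c x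
    by (rule oproj_eqI[OF L]) (use L in \<open>auto simp: oproj_mem subspace_mul inner_simps inner_commute inner_oproj\<close>)
qed

lemma oproj_orthonormal_basis:
  assumes B: "finite B" "\<And>b b'. b \<in> B \<Longrightarrow> b' \<in> B \<Longrightarrow> b \<bullet> b' = (if b = b' then 1 else 0)"
  shows "oproj (span B) x = (\<Sum>b\<in>B. (x \<bullet> b) *\<^sub>R b)"
proof (rule oproj_eqI)
  show "(\<Sum>b\<in>B. (x \<bullet> b) *\<^sub>R b) \<in> span B" by (intro span_sum span_mul span_base)
  fix z assume "z \<in> span B"
  then show "(x - (\<Sum>b\<in>B. (x \<bullet> b) *\<^sub>R b)) \<bullet> z = 0"
  proof (induction rule: span_induct)
    case base
    show ?case by (auto simp: subspace_def inner_simps)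
  next
    case (step c)
    have "(\<Sum>b\<in>B. (x \<bullet> b) *\<^sub>R b) \<bullet> c = (\<Sum>b\<in>B. if b = c then x \<bullet> b else 0)"
      unfolding inner_sum_left using B(2) step by (intro sum.cong refl) auto
    then show ?case using B(1) step by (simp add: inner_simps)
  qed
qed simp

text \<open>This removes the basis chosen in the definition: the coordinates of a standard Gaussian vector in
any orthonormal basis of \<open>L\<close> are independent and standard normal, and they are the coordinates of
its projection to \<open>L\<close>.\<close>

lemma gaussian_on_eq:
  assumes L: "subspace L"
  shows "gaussian_on L = distr std_gauss borel (oproj L)"
proof -
  define B where "B = (SOME B. orthonormal_basis_of B L)"
  have "\<exists>B. orthonormal_basis_of B L"
    using orthonormal_basis_subspace[OF L] unfolding orthonormal_basis_of_def by metis
  then have "orthonormal_basis_of B L" unfolding B_def by (rule someI_ex)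
  then have B: "\<And>b b'. b \<in> B \<Longrightarrow> b' \<in> B \<Longrightarrow> b \<bullet> b' = (if b = b' then 1 else 0)" and span: "span B = L"
    by (auto simp: orthonormal_basis_of_def pairwise_def orthogonal_def norm_eq_1)
  have fB: "finite B" using finite_orthonormal_family[of B "\<lambda>b. b"] B by blast
  have "gaussian_on L = distr (PiM B (\<lambda>_. std_normal)) borel (\<lambda>g. \<Sum>b\<in>B. g b *\<^sub>R b)"
    unfolding gaussian_on_def B_def[symmetric] Let_def ..
  also have "\<dots> = distr (distr std_gauss (PiM B (\<lambda>_. borel)) (\<lambda>x. \<lambda>b\<in>B. x \<bullet> b)) borel (\<lambda>g. \<Sum>b\<in>B. g b *\<^sub>R b)"
    by (subst distr_std_gauss_orthonormal_coords[of B "\<lambda>b. b"]) (use B in auto)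
  also have "\<dots> = distr std_gauss borel (oproj L)"
  proof -
    have "oproj L = (\<lambda>x. \<Sum>b\<in>B. (x \<bullet> b) *\<^sub>R b)"
      using oproj_orthonormal_basis[OF fB B] unfolding span by blast
    then show ?thesis
      using fB by (subst distr_distr) (auto simp: o_def)
  qed
  finally show ?thesis .
qed

lemma measurable_oproj: "subspace L \<Longrightarrow> oproj L \<in> borel_measurable borel"
  by (intro borel_measurable_linear linear_oproj)

lemma
  assumes L: "subspace L"
  shows prob_space_gaussian_on: "prob_space (gaussian_on L)"
    and sets_gaussian_on: "sets (gaussian_on L) = sets borel"
    and AE_gaussian_on_mem: "AE x in gaussian_on L. x \<in> L"
proof -
  note [measurable] = measurable_oproj[OF L]
  show "prob_space (gaussian_on L)" "sets (gaussian_on L) = sets borel"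
    unfolding gaussian_on_eq[OF L] by (simp_all add: std_gauss.prob_space_distr)
  show "AE x in gaussian_on L. x \<in> L"
    unfolding gaussian_on_eq[OF L] using oproj_mem[OF L] closed_subspace[OF L]
    by (subst AE_distr_iff) simp_all
qed

lemma AE_gaussian_on_hyperplane:
  assumes L: "subspace L" and a: "a \<in> L" "a \<noteq> 0"
  shows "AE x in gaussian_on L. a \<bullet> x \<noteq> 0"
proof -
  note [measurable] = measurable_oproj[OF L]
  show ?thesis
    unfolding gaussian_on_eq[OF L] using AE_std_gauss_hyperplane[OF a(2)]
    by (subst AE_distr_iff) (auto simp: inner_oproj[OF L a(1)])
qed

text \<open>An involution that maps \<open>L\<close> into itself maps it onto itself, so that \<open>f\<close> commutes with the
projection to \<open>L\<close> and the rotation invariance of \<open>std_gauss\<close> carries over.\<close>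

lemma distr_gaussian_on_orthogonal_transformation:
  fixes f :: "'a::euclidean_space \<Rightarrow> 'a"
  assumes L: "subspace L" and f: "orthogonal_transformation f" "\<And>x. x \<in> L \<Longrightarrow> f x \<in> L" and inv: "\<And>x. f (f x) = x"
  shows "distr (gaussian_on L) borel f = gaussian_on L"
proof -
  note [measurable] = measurable_oproj[OF L]
  have [measurable]: "f \<in> borel_measurable borel"
    using f by (intro borel_measurable_linear orthogonal_transformation_linear)
  have "f (oproj L x) = oproj L (f x)" for x
  proof (rule oproj_eqI[OF L, symmetric])
    show "f (oproj L x) \<in> L" using f oproj_mem[OF L] by blast
    fix z assume "z \<in> L"
    have lf: "linear f" using f(1) by (rule orthogonal_transformation_linear)
    have "(f x - f (oproj L x)) \<bullet> z = f (x - oproj L x) \<bullet> f (f z)" by (simp add: linear_diff[OF lf] inv)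
    also have "\<dots> = (x - oproj L x) \<bullet> f z" using f(1) by (simp only: orthogonal_transformation_def)
    also have "\<dots> = 0" using oproj_orthogonal[OF L] f(2) \<open>z \<in> L\<close> by blast
    finally show "(f x - f (oproj L x)) \<bullet> z = 0" .
  qed
  then have "distr (gaussian_on L) borel f = distr (distr std_gauss borel f) borel (oproj L)"
    unfolding gaussian_on_eq[OF L] by (simp add: distr_distr o_def)
  then show ?thesis by (simp add: gaussian_on_eq[OF L] distr_std_gauss_orthogonal_transformation[OF f(1)])
qed

section \<open>Gaussian measures on products of subspaces\<close>

lemma distr_std_gauss_vec_nth: "distr (std_gauss :: ('a::euclidean_space ^ 'i) measure) borel (\<lambda>x. x $ i) = std_gauss"
proof -
  let ?e = "\<lambda>x::'a^'i. \<lambda>e\<in>Basis. x \<bullet> axis i e"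
  have [measurable]: "(\<lambda>x::'a^'i. x $ i) \<in> borel_measurable borel"
    by (intro borel_measurable_linear) (simp add: linear_iff)
  have "std_gauss = distr (distr std_gauss (PiM Basis (\<lambda>_. borel)) ?e) borel (\<lambda>g. \<Sum>b\<in>(Basis::'a set). g b *\<^sub>R b)"
    unfolding std_gauss_def[where 'a='a]
    by (subst distr_std_gauss_orthonormal_coords) (auto simp: inner_axis_axis inner_Basis)
  also have "\<dots> = distr std_gauss borel (\<lambda>x. x $ i)"
    by (subst distr_distr) (auto simp: o_def inner_axis euclidean_representation)
  finally show ?thesis ..
qed

text \<open>The coordinates in the standard basis are independent, and the components of a vector of vectors are
functions of disjoint blocks of coordinates.\<close>

lemma measure_std_gauss_set_product:
  fixes A :: "'i::finite \<Rightarrow> 'a::euclidean_space set"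
  assumes A: "\<And>i. A i \<in> sets borel"
  shows "measure std_gauss (set_product A) = (\<Prod>i\<in>UNIV. measure std_gauss (A i))"
proof -
  let ?B = "Basis :: ('a^'i) set"
  have coords: "distr std_gauss (PiM ?B (\<lambda>_. borel)) (\<lambda>x. \<lambda>b\<in>?B. x \<bullet> b) = PiM ?B (\<lambda>_. std_normal)"
    using distr_std_gauss_orthonormal_coords[of ?B "\<lambda>b. b"] by (auto simp: inner_Basis)
  have coord: "distr std_gauss borel (\<lambda>x. x \<bullet> b) = std_normal" if b: "b \<in> ?B" for b
  proof -
    have "std_normal = distr (PiM ?B (\<lambda>_. std_normal)) std_normal (\<lambda>g. g b)"
      using std_normals.PiM_component[OF b] by simp
    also have "\<dots> = distr (distr std_gauss (PiM ?B (\<lambda>_. borel)) (\<lambda>x. \<lambda>b\<in>?B. x \<bullet> b)) borel (\<lambda>g. g b)"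
      unfolding coords by (rule distr_cong) auto
    also have "\<dots> = distr std_gauss borel (\<lambda>x. x \<bullet> b)"
      using b by (subst distr_distr) (auto simp: o_def)
    finally show ?thesis ..
  qed
  have "std_gauss.indep_vars (\<lambda>_. borel) (\<lambda>b x. x \<bullet> b) ?B"
  proof (subst std_gauss.indep_vars_iff_distr_eq_PiM')
    show "distr std_gauss (PiM ?B (\<lambda>_. borel)) (\<lambda>x. \<lambda>b\<in>?B. x \<bullet> b)
      = (\<Pi>\<^sub>M b\<in>?B. distr std_gauss borel (\<lambda>x. x \<bullet> b))"
      unfolding coords using coord by (intro PiM_cong refl) simp
  qed auto
  then have "std_gauss.indep_vars (\<lambda>i. PiM (axis i ` Basis) (\<lambda>_. borel)) (\<lambda>i x. \<lambda>b\<in>axis i ` (Basis::'a set). x \<bullet> b) (UNIV::'i set)"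
    by (rule std_gauss.indep_vars_restrict[of "\<lambda>_. borel" "\<lambda>b x. x \<bullet> b" ?B UNIV "\<lambda>i. axis i ` Basis"])
       (auto simp: disjoint_family_on_def axis_eq_axis axis_in_Basis_iff)
  then have "std_gauss.indep_vars (\<lambda>_. borel)
     (\<lambda>i x. \<Sum>e\<in>(Basis::'a set). (\<lambda>b\<in>axis i ` (Basis::'a set). x \<bullet> b) (axis i e) *\<^sub>R e) (UNIV::'i set)"
    by (rule std_gauss.indep_vars_compose2) auto
  then have ind: "std_gauss.indep_vars (\<lambda>_. borel) (\<lambda>i x. (x::'a^'i) $ i) UNIV"
    by (simp add: inner_axis euclidean_representation)
  have [measurable]: "(\<lambda>x::'a^'i. x $ i) \<in> borel_measurable borel" for i
    by (intro borel_measurable_linear) (simp add: linear_iff)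
  have "set_product A = (\<Inter>i\<in>UNIV. (\<lambda>x. x $ i) -` A i \<inter> space std_gauss)"
    by (auto simp: set_product_def)
  then have "measure std_gauss (set_product A) = (\<Prod>i\<in>UNIV. measure std_gauss ((\<lambda>x. x $ i) -` A i \<inter> space std_gauss))"
    using std_gauss.indep_varsD[OF ind, of UNIV A] A by simp
  also have "\<dots> = (\<Prod>i\<in>UNIV. measure (distr std_gauss borel (\<lambda>x::'a^'i. x $ i)) (A i))"
    using A by (intro prod.cong refl) (simp add: measure_distr)
  finally show ?thesis by (simp add: distr_std_gauss_vec_nth)
qed

lemma subspace_set_product:
  "(\<And>i. subspace (L i)) \<Longrightarrow> subspace (set_product L)"
  by (auto simp: set_product_def subspace_def)

lemma oproj_set_product:
  assumes L: "\<And>i. subspace (L i)"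
  shows "oproj (set_product L) x = (\<chi> i. oproj (L i) (x $ i))"
  by (rule oproj_eqI[OF subspace_set_product[OF L]])
     (auto simp: set_product_def oproj_mem[OF L] inner_vec_def oproj_orthogonal[OF L])

lemma mem_set_product: "x \<in> set_product X \<longleftrightarrow> (\<forall>i. x $ i \<in> X i)"
  by (simp add: set_product_def)

lemma measure_gaussian_on_set_product:
  fixes A :: "'i::finite \<Rightarrow> 'a::euclidean_space set"
  assumes L: "\<And>i. subspace (L i)" and A[measurable]: "\<And>i. A i \<in> sets borel"
  shows "measure (gaussian_on (set_product L)) (set_product A) = (\<Prod>i\<in>UNIV. measure (gaussian_on (L i)) (A i))"
proof -
  note sL = subspace_set_product[of L, OF L]
  note [measurable] = measurable_oproj[OF sL] measurable_oproj[OF L]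
  have [measurable]: "(\<lambda>x::'a^'i. x $ i) \<in> borel_measurable borel" for i
    by (intro borel_measurable_linear) (simp add: linear_iff)
  have "{x\<in>space borel. \<forall>i. (x::'a^'i) $ i \<in> A i} \<in> sets borel" by measurable
  then have [measurable]: "set_product A \<in> sets borel" by (simp add: set_product_def)
  have "measure (gaussian_on (set_product L)) (set_product A)
     = measure std_gauss (set_product (\<lambda>i. oproj (L i) -` A i))"
  proof -
    have "oproj (set_product L) -` set_product A = set_product (\<lambda>i. oproj (L i) -` A i)"
      by (simp add: set_eq_iff mem_set_product oproj_set_product[OF L])
    then show ?thesis
      unfolding gaussian_on_eq[OF sL] by (subst measure_distr) auto
  qed
  also have "\<dots> = (\<Prod>i\<in>UNIV. measure std_gauss (oproj (L i) -` A i))"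
    using measurable_sets[OF measurable_oproj[OF L] A] by (intro measure_std_gauss_set_product) simp
  also have "\<dots> = (\<Prod>i\<in>UNIV. measure (gaussian_on (L i)) (A i))"
    unfolding gaussian_on_eq[OF L] by (intro prod.cong refl) (simp add: measure_distr)
  finally show ?thesis .
qed

text \<open>The right-hand side is the trace of the projection. It shows that the dimension of a random
subspace is measurable as soon as the projection is.\<close>

lemma dim_eq_sum_oproj:
  fixes L :: "'a::euclidean_space set"
  assumes L: "subspace L"
  shows "real (dim L) = (\<Sum>e\<in>Basis. e \<bullet> oproj L e)"
proof -
  obtain B where B: "pairwise orthogonal B" "\<And>x. x \<in> B \<Longrightarrow> norm x = 1" "independent B" "card B = dim L" "span B = L"
    using orthonormal_basis_subspace[OF L] by metis
  then have B': "\<And>b b'. b \<in> B \<Longrightarrow> b' \<in> B \<Longrightarrow> b \<bullet> b' = (if b = b' then 1 else 0)"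
    by (auto simp: pairwise_def orthogonal_def norm_eq_1)
  have fB: "finite B" using B(3) independent_imp_finite by blast
  have "(\<Sum>e\<in>Basis. e \<bullet> oproj L e) = (\<Sum>e\<in>(Basis::'a set). \<Sum>b\<in>B. (b \<bullet> e) * (b \<bullet> e))"
  proof (rule sum.cong[OF refl])
    fix e :: 'a
    have "oproj L e = (\<Sum>b\<in>B. (e \<bullet> b) *\<^sub>R b)"
      using oproj_orthonormal_basis[OF fB B', of e] unfolding B(5) by blast
    then show "e \<bullet> oproj L e = (\<Sum>b\<in>B. (b \<bullet> e) * (b \<bullet> e))"
      by (simp add: inner_sum_right inner_commute)
  qed
  also have "\<dots> = (\<Sum>b\<in>B. \<Sum>e\<in>(Basis::'a set). (b \<bullet> e) * (b \<bullet> e))" by (rule sum.swap)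
  also have "\<dots> = (\<Sum>b\<in>B. 1)" using B' by (simp add: euclidean_inner[symmetric])
  finally show ?thesis using B(4) by simp
qed

lemma dim_set_product:
  fixes L :: "'i::finite \<Rightarrow> 'a::euclidean_space set"
  assumes L: "\<And>i. subspace (L i)"
  shows "dim (set_product L) = (\<Sum>i\<in>UNIV. dim (L i))"
proof -
  have zero: "oproj (L j) 0 = 0" for j using linear_oproj[OF L] by (rule linear_0)
  have "real (dim (set_product L)) = (\<Sum>b\<in>(Basis::('a^'i) set). b \<bullet> oproj (set_product L) b)"
    by (rule dim_eq_sum_oproj[OF subspace_set_product[OF L]])
  also have "\<dots> = (\<Sum>(i,e)\<in>UNIV \<times> Basis. axis i e \<bullet> oproj (set_product L) (axis i e :: 'a^'i))"
  proof -
    have "bij_betw (\<lambda>(i, e). axis i e) (UNIV \<times> Basis) (Basis::('a^'i) set)"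
      by (auto simp: bij_betw_def inj_on_def axis_eq_axis Basis_vec_def nonzero_Basis)
    from sum.reindex_bij_betw[OF this, of "\<lambda>b. b \<bullet> oproj (set_product L) b"]
    show ?thesis by (simp add: case_prod_beta)
  qed
  also have "\<dots> = (\<Sum>(i,e)\<in>UNIV \<times> Basis. e \<bullet> oproj (L i) e)"
    by (intro sum.cong refl) (auto simp: inner_axis' oproj_set_product[OF L])
  also have "\<dots> = (\<Sum>i\<in>UNIV. real (dim (L i)))"
    by (simp add: sum.cartesian_product[symmetric] dim_eq_sum_oproj[OF L])
  finally show ?thesis by (metis of_nat_eq_iff of_nat_sum)
qed

section \<open>Uniqueness of uniformly distributed measures\<close>

text \<open>This is Christensen's argument. For \<open>f\<close> continuous, the average of \<open>f\<close> with respect to \<open>N\<close> over a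
small ball around \<open>x\<close> is close to \<open>f x\<close>. Integrate this average over \<open>x\<close> with respect to \<open>M\<close> and
exchange the integrals: since balls with centres in \<open>S\<close> and equal radius have equal mass, the result
is exactly the integral of \<open>f\<close> with respect to \<open>N\<close>.\<close>

lemma measure_eq_of_uniform_balls:
  fixes M N :: "'a::euclidean_space measure"
  assumes M: "prob_space M" "sets M = sets borel" "AE x in M. x \<in> S"
    and N: "prob_space N" "sets N = sets borel" "AE x in N. x \<in> S"
    and ballM: "\<And>x y r. x \<in> S \<Longrightarrow> y \<in> S \<Longrightarrow> 0 < r \<Longrightarrow> measure M (ball x r) = measure M (ball y r)"
    and ballN: "\<And>x y r. x \<in> S \<Longrightarrow> y \<in> S \<Longrightarrow> 0 < r \<Longrightarrow> measure N (ball x r) = measure N (ball y r)"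
  shows "M = N"
proof -
  interpret M: prob_space M by fact
  interpret N: prob_space N by fact
  interpret P: pair_prob_space M N ..
  note [measurable_cong] = M(2) N(2)
  have spM: "space M = UNIV" and spN: "space N = UNIV"
    using sets_eq_imp_space_eq[OF M(2)] sets_eq_imp_space_eq[OF N(2)] by auto
  obtain s where s: "s \<in> S"
    using M.ae_filter_bot M(3) by (metis eventually_False eventually_mono)
  have pos: "measure K (ball s r) > 0"
    if K: "prob_space K" "sets K = sets borel" "AE x in K. x \<in> S"
      and bK: "\<And>x y r. x \<in> S \<Longrightarrow> y \<in> S \<Longrightarrow> 0 < r \<Longrightarrow> measure K (ball x r) = measure K (ball y r)"
      and r: "0 < r"
    for K and r :: real
  proof (rule ccontr)
    interpret K: prob_space K by fact
    assume "\<not> measure K (ball s r) > 0"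
    then have z: "measure K (ball x r) = 0" if "x \<in> S" for x
      using bK[OF that s r] by (simp add: zero_less_measure_iff)
    \<comment> \<open>If these balls were null sets, the countably many of them with centres in a dense subset would cover S.\<close>
    obtain B where B: "countable B" "B \<subseteq> S" "S \<subseteq> closure B" using separable by blast
    have "AE x in K. \<forall>b\<in>B. x \<notin> ball b r"
    proof (subst AE_ball_countable[OF B(1)], rule ballI)
      fix b assume "b \<in> B"
      then have "ball b r \<in> null_sets K" using B(2) z K(2) by (auto simp: null_sets_def K.emeasure_eq_measure)
      then show "AE x in K. x \<notin> ball b r" by (rule AE_not_in)
    qed
    then have "AE x in K. False"
      using K(3)
    proof eventually_elim
      fix x assume x: "\<forall>b\<in>B. x \<notin> ball b r" "x \<in> S"
      then obtain b where "b \<in> B" "dist b x < r" using B(3) r by (meson closure_approachable subsetD)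
      then show False using x by auto
    qed
    then show False using K.ae_filter_bot by (simp add: eventually_False)
  qed
  have integral_eq: "integral\<^sup>L M f = integral\<^sup>L N f"
    if f: "continuous_on UNIV f" "\<And>x. 0 \<le> f x \<and> f x \<le> 1" for f :: "'a \<Rightarrow> real"
  proof -
    have [measurable]: "f \<in> borel_measurable borel" using f(1) by (rule borel_measurable_continuous_onI)
    define r where "r n = 1 / real (Suc n)" for n
    have r: "r n > 0" for n by (simp add: r_def)
    define m where "m n = measure M (ball s (r n))" for n
    define c where "c n = measure N (ball s (r n))" for n
    have mpos: "m n > 0" and cpos: "c n > 0" for n
      using pos[OF M ballM r] pos[OF N ballN r] by (auto simp: m_def c_def)
    \<comment> \<open>k n x y tells whether x and y are at distance less than r n; it is integrated over x first or over y first.\<close>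
    define k where "k n x y = (indicator (ball x (r n)) y :: real)" for n and x y :: 'a
    have k_sym: "k n x y = k n y x" for n x y by (simp add: k_def indicator_def dist_commute)
    have [measurable]: "case_prod (k n) \<in> borel_measurable (borel \<Otimes>\<^sub>M borel)" for n
    proof -
      have "case_prod (k n) = indicator {p. dist (fst p) (snd p) < r n}"
        by (auto simp: k_def indicator_def fun_eq_iff)
      moreover have "{p::'a\<times>'a. dist (fst p) (snd p) < r n} \<in> sets (borel \<Otimes>\<^sub>M borel)"
        unfolding borel_prod by (intro borel_open open_Collect_less continuous_intros)
      ultimately show ?thesis by simp
    qed
    have kM: "(\<integral>x. k n x y \<partial>M) = m n" if "y \<in> S" for n y
      unfolding k_sym[of n _ y] using ballM[OF that s r, of n] by (simp add: k_def m_def spM)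
    have kN: "(\<integral>y. k n x y \<partial>N) = c n" if "x \<in> S" for n x
      using ballN[OF that s r, of n] by (simp add: k_def c_def spN)
    have bk: "0 \<le> k n x y" "k n x y \<le> 1" for n x y by (auto simp: k_def indicator_def)
    have bkf: "0 \<le> k n x y * f y" "k n x y * f y \<le> 1" for n x y
      using bk f(2) by (auto intro: mult_le_one)
    have fub: "(\<integral>x. (\<integral>y. k n x y * g y \<partial>N) \<partial>M) = m n * integral\<^sup>L N g"
      if [measurable]: "g \<in> borel_measurable borel" and g: "\<And>x. \<bar>g x\<bar> \<le> 1" for g n
    proof -
      have int: "integrable (M \<Otimes>\<^sub>M N) (\<lambda>(x, y). k n x y * g y)"
        by (rule P.integrable_const_bound[where B=1])
           (use bk g in \<open>auto intro!: mult_le_one simp: abs_mult abs_of_nonneg split_beta'\<close>)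
      have "(\<integral>x. (\<integral>y. k n x y * g y \<partial>N) \<partial>M) = (\<integral>y. (\<integral>x. k n x y * g y \<partial>M) \<partial>N)"
        using P.Fubini_integral[OF int] by simp
      also have "\<dots> = (\<integral>y. m n * g y \<partial>N)"
        by (rule integral_cong_AE) (use N(3) kM in \<open>auto elim!: eventually_mono\<close>)
      finally show ?thesis by simp
    qed
    \<comment> \<open>Both sides are the integral of k n over both variables.\<close>
    have mc: "c n = m n" for n
    proof -
      have "m n = (\<integral>x. (\<integral>y. k n x y \<partial>N) \<partial>M)"
        using fub[of "\<lambda>_. 1" n] by (simp add: N.prob_space)
      also have "\<dots> = (\<integral>x. c n \<partial>M)"
        by (rule integral_cong_AE) (use M(3) kN in \<open>auto elim!: eventually_mono\<close>)
      finally show ?thesis by (simp add: M.prob_space)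
    qed
    define F where "F n x = (\<integral>y. k n x y * f y \<partial>N) / m n" for n x
    have [measurable]: "F n \<in> borel_measurable borel" for n
      unfolding F_def by measurable
    have int_kf: "integrable N (\<lambda>y. k n x y * f y)" "integrable N (k n x)" for n x
      using bk bkf by (auto intro!: N.integrable_const_bound[where B=1] simp del: abs_mult)
    have F_le: "\<bar>F n x\<bar> \<le> 1" if x: "x \<in> S" for n x
    proof -
      have "(\<integral>y. k n x y * f y \<partial>N) \<le> (\<integral>y. k n x y \<partial>N)"
        by (rule integral_mono) (use int_kf bk f(2) in \<open>auto simp: mult_left_le\<close>)
      moreover have "0 \<le> (\<integral>y. k n x y * f y \<partial>N)"
        by (rule integral_nonneg_AE) (use bk f(2) in auto)
      ultimately show ?thesis using kN[OF x, of n] mc[of n] mpos[of n] by (simp add: F_def abs_le_iff field_simps)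
    qed
    have F_lim: "(\<lambda>n. F n x) \<longlonglongrightarrow> f x" if x: "x \<in> S" for x
    proof (rule LIMSEQ_I)
      fix e :: real assume "0 < e"
      have "isCont f x" using f(1) by (simp add: continuous_on_eq_continuous_at)
      then obtain d where d: "d > 0" "\<And>y. dist y x < d \<Longrightarrow> dist (f y) (f x) < e / 2"
        using \<open>0 < e\<close> unfolding continuous_at_eps_delta by (meson half_gt_zero)
      obtain n0 where n0: "r n0 < d" using d(1) reals_Archimedean unfolding r_def by (metis inverse_eq_divide)
      show "\<exists>no. \<forall>n\<ge>no. norm (F n x - f x) < e"
      proof (intro exI allI impI)
        fix n assume "n \<ge> n0"
        then have rn: "r n < d" using n0 by (smt (verit) frac_le of_nat_0_less_iff of_nat_mono r_def zero_less_Suc Suc_le_mono)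
        have "F n x - f x = (\<integral>y. k n x y * (f y - f x) \<partial>N) / m n"
        proof -
          have "(\<integral>y. k n x y * (f y - f x) \<partial>N) = (\<integral>y. k n x y * f y \<partial>N) - (\<integral>y. k n x y * f x \<partial>N)"
            unfolding right_diff_distrib using int_kf by (intro Bochner_Integration.integral_diff) auto
          then show ?thesis using kN[OF x, of n] mc[of n] mpos[of n] by (simp add: F_def field_simps)
        qed
        moreover have "\<bar>\<integral>y. k n x y * (f y - f x) \<partial>N\<bar> \<le> (\<integral>y. k n x y * (e / 2) \<partial>N)"
        proof (rule order_trans[OF integral_abs_bound], rule integral_mono)
          show "integrable N (\<lambda>y. \<bar>k n x y * (f y - f x)\<bar>)"
            unfolding right_diff_distrib using int_kf by (intro integrable_abs Bochner_Integration.integrable_diff) auto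
          show "integrable N (\<lambda>y. k n x y * (e / 2))" using int_kf by auto
          show "\<bar>k n x y * (f y - f x)\<bar> \<le> k n x y * (e / 2)" for y
          proof (cases "dist x y < r n")
            case True
            then have "\<bar>f y - f x\<bar> < e / 2" using d(2)[of y] rn by (simp add: dist_commute dist_real_def abs_minus_commute)
            then show ?thesis using True by (simp add: k_def)
          qed (simp add: k_def)
        qed
        ultimately have "\<bar>F n x - f x\<bar> \<le> e / 2"
          using kN[OF x, of n] mc[of n] mpos[of n] by (simp add: pos_divide_le_eq mult.commute)
        then show "norm (F n x - f x) < e" using \<open>0 < e\<close> by simp
      qed
    qed
    have "(\<lambda>n. integral\<^sup>L M (F n)) \<longlonglongrightarrow> integral\<^sup>L M f"
      by (rule integral_dominated_convergence[where w="\<lambda>_. 1"])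
         (use M(3) F_lim F_le in \<open>auto elim!: eventually_mono\<close>)
    moreover have "integral\<^sup>L M (F n) = integral\<^sup>L N f" for n
    proof -
      have "integral\<^sup>L M (F n) = (\<integral>x. (\<integral>y. k n x y * f y \<partial>N) \<partial>M) / m n" by (simp add: F_def[abs_def])
      also have "\<bar>f x\<bar> \<le> 1" for x using f(2)[of x] by auto
      then have "(\<integral>x. (\<integral>y. k n x y * f y \<partial>N) \<partial>M) = m n * integral\<^sup>L N f" by (intro fub) auto
      finally show ?thesis using mpos[of n] by simp
    qed
    ultimately have "(\<lambda>n::nat. integral\<^sup>L N f) \<longlonglongrightarrow> integral\<^sup>L M f" by simp
    then show ?thesis using tendsto_const[of "integral\<^sup>L N f" sequentially] by (rule LIMSEQ_unique)
  qed
  have closed_eq: "measure M X = measure N X" if X: "closed X" "X \<noteq> {}" for X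
  proof -
    \<comment> \<open>Continuous functions decreasing to the indicator of X.\<close>
    define f where "f n x = max 0 (1 - real n * setdist {x} X)" for n and x :: 'a
    have cont: "continuous_on UNIV (f n)" for n
      unfolding f_def by (intro continuous_intros continuous_on_setdist)
    then have [measurable]: "f n \<in> borel_measurable borel" for n by (rule borel_measurable_continuous_onI)
    have b: "0 \<le> f n x \<and> f n x \<le> 1" for n x by (auto simp: f_def setdist_pos_le)
    have lim: "(\<lambda>n. f n x) \<longlonglongrightarrow> indicator X x" for x
    proof (cases "x \<in> X")
      case True
      then show ?thesis by (simp add: f_def setdist_sing_in_set)
    next
      case False
      then have "setdist {x} X > 0" using X
        by (metis less_eq_real_def setdist_eq_0_closed setdist_pos_le)
      then obtain n0 where n0: "real n0 * setdist {x} X > 1" using reals_Archimedean3 by blast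
      have "f n x = 0" if "n \<ge> n0" for n
      proof -
        have "real n0 * setdist {x} X \<le> real n * setdist {x} X"
          using that by (intro mult_right_mono) (auto simp: setdist_pos_le)
        then show ?thesis using n0 by (simp add: f_def)
      qed
      then show ?thesis using False
        by (intro tendsto_eventually) (auto simp: eventually_sequentially)
    qed
    have "(\<lambda>n. integral\<^sup>L K (f n)) \<longlonglongrightarrow> measure K X"
      if K: "prob_space K" "sets K = sets borel" for K
    proof -
      interpret K: prob_space K by fact
      note [measurable_cong] = K(2)
      have [measurable]: "X \<in> sets borel" using X by simp
      have "(\<lambda>n. integral\<^sup>L K (f n)) \<longlonglongrightarrow> integral\<^sup>L K (indicator X :: _ \<Rightarrow> real)"
        by (rule integral_dominated_convergence[where w="\<lambda>_. 1"]) (use b lim in auto)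
      then show ?thesis using sets_eq_imp_space_eq[OF K(2)] by simp
    qed
    from this[OF M(1,2)] this[OF N(1,2)] show ?thesis
      unfolding integral_eq[OF cont b] by (rule LIMSEQ_unique)
  qed
  show ?thesis
  proof (rule measure_eqI_generator_eq[where E="Collect closed" and A="\<lambda>_. UNIV" and \<Omega>=UNIV])
    show "Int_stable (Collect closed)" by (auto simp: Int_stable_def)
    show "emeasure M X = emeasure N X" if "X \<in> Collect closed" for X
      using closed_eq[of X] that by (cases "X = {}") (auto simp: M.emeasure_eq_measure N.emeasure_eq_measure)
    have "sets (borel :: 'a measure) = sigma_sets UNIV (Collect closed)"
      unfolding borel_eq_closed by (rule sets_measure_of) simp
    then show "sets M = sigma_sets UNIV (Collect closed)" "sets N = sigma_sets UNIV (Collect closed)"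
      unfolding M(2) N(2) by assumption+
    show "emeasure M UNIV \<noteq> \<infinity>" using M.emeasure_finite[of UNIV] by (simp only: infinity_ennreal_def not_False_eq_True)
    show "range (\<lambda>_. UNIV) \<subseteq> Collect (closed :: 'a set \<Rightarrow> bool)" by blast
    show "(\<Union>i::nat. UNIV) = (UNIV :: 'a set)" by blast
    show "Collect closed \<subseteq> Pow (UNIV :: 'a set)" by blast
  qed
qed

section \<open>Measurable dependence of orthogonal projections on the subspace\<close>

text \<open>Here \<open>y n\<close> is the image of \<open>x\<close> under the inverse of \<open>1 + n B\<close>. The kernel of \<open>B\<close> is fixed by this
inverse, and its orthogonal complement is the range of \<open>B\<close>. The inverse does not increase norms,
because \<open>B\<close> is positive semidefinite, and therefore maps \<open>B w\<close> to a vector of norm at most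
\<open>2 * norm w / n\<close>.\<close>

lemma resolvent_tendsto_oproj_kernel:
  fixes B :: "'a::euclidean_space \<Rightarrow> 'a"
  assumes B: "linear B" and sym: "\<And>x y. x \<bullet> B y = B x \<bullet> y" and psd: "\<And>x. 0 \<le> x \<bullet> B x"
    and y: "\<And>n::nat. y n + real n *\<^sub>R B (y n) = x"
  shows "y \<longlonglongrightarrow> oproj {x. B x = 0} x"
proof -
  let ?K = "{x. B x = 0}"
  have K: "subspace ?K" using B by (auto simp: subspace_def linear_0 linear_add linear_scale)
  define p where "p = oproj ?K x"
  have Bp: "B p = 0" using oproj_mem[OF K, of x] by (simp add: p_def)
  have rB: "subspace (range B)" using B by (rule linear_subspace_image) simp
  define r where "r = oproj (range B) (x - p)"
  have r: "r \<in> range B" using oproj_mem[OF rB] by (simp add: r_def)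
  define s where "s = x - p - r"
  have s: "s \<bullet> B w = 0" for w using oproj_orthogonal[OF rB, of "B w" "x - p"] by (simp add: s_def r_def)
  then have "B s \<bullet> w = 0" for w by (simp add: sym)
  then have "B s = 0" by (metis inner_eq_zero_iff)
  then have "(x - p) \<bullet> s = 0" using oproj_orthogonal[OF K, of s x] by (simp add: p_def)
  moreover have "r \<bullet> s = 0" using r s by (auto simp: inner_commute)
  ultimately have "s \<bullet> s = 0" by (simp add: s_def inner_simps)
  then obtain w where w: "x - p = B w" using r by (auto simp: s_def)
  have bound: "norm (y n - p) \<le> 2 * norm w / real n" if n: "n > 0" for n
  proof -
    define e where "e = y n - p"
    \<comment> \<open>Then B w' = e, so that w' is the image of w under the inverse of 1 + n B.\<close>
    define w' where "w' = w - real n *\<^sub>R e"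
    have "e + real n *\<^sub>R B e = B w"
      using y[of n] w by (simp add: e_def linear_diff[OF B] Bp algebra_simps)
    then have e: "e = B w'"
      by (simp add: w'_def linear_diff[OF B] linear_scale[OF B] algebra_simps)
    have w2: "w = w' + real n *\<^sub>R B w'" using e by (simp add: w'_def)
    have "norm w' * norm w' \<le> w' \<bullet> w'" by (simp add: dot_square_norm power2_eq_square)
    also have "\<dots> \<le> w' \<bullet> w"
      by (subst w2) (simp add: inner_simps psd)
    also have "\<dots> \<le> norm w' * norm w" by (rule norm_cauchy_schwarz)
    finally have "norm w' \<le> norm w" by (cases "w' = 0") auto
    moreover have "real n * norm e = norm (w - w')" by (simp add: w'_def)
    ultimately have "real n * norm e \<le> 2 * norm w" using norm_triangle_ineq4[of w w'] by linarith
    then show ?thesis using n by (simp add: e_def field_simps)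
  qed
  have "(\<lambda>n. 2 * norm w / real n) \<longlonglongrightarrow> 0" by (rule lim_const_over_n)
  then have "(\<lambda>n. y n - p) \<longlonglongrightarrow> 0"
    by (rule Lim_null_comparison[rotated]) (use bound in \<open>auto simp: eventually_sequentially intro!: exI[of _ 1]\<close>)
  then show ?thesis unfolding p_def[symmetric] by (rule LIM_zero_cancel)
qed

lemma borel_measurable_vecI:
  fixes f :: "'w \<Rightarrow> 'a::euclidean_space ^ 'n"
  assumes f: "\<And>i. (\<lambda>w. f w $ i) \<in> borel_measurable M"
  shows "f \<in> borel_measurable M"
proof (subst borel_measurable_euclidean_space, rule ballI)
  fix b :: "'a^'n" assume "b \<in> Basis"
  then obtain i u where "b = axis i u" by (auto simp: Basis_vec_def)
  then show "(\<lambda>w. f w \<bullet> b) \<in> borel_measurable M" using f[of i] by (simp add: inner_axis)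
qed

lemma borel_measurable_vec_nth [measurable (raw)]:
  fixes f :: "'w \<Rightarrow> 'a::euclidean_space ^ 'n"
  assumes f: "f \<in> borel_measurable M"
  shows "(\<lambda>w. f w $ i) \<in> borel_measurable M"
proof -
  have "(\<lambda>x::'a^'n. x $ i) \<in> borel_measurable borel" by (intro borel_measurable_linear) (simp add: linear_iff)
  from measurable_compose[OF f this] show ?thesis .
qed

lemma borel_measurable_matrix_vector_mult [measurable (raw)]:
  fixes A :: "'w \<Rightarrow> real ^ 'n ^ 'm"
  assumes [measurable]: "A \<in> borel_measurable M" "x \<in> borel_measurable M"
  shows "(\<lambda>w. A w *v x w) \<in> borel_measurable M"
  by (rule borel_measurable_vecI) (simp add: matrix_vector_mult_def)

lemma borel_measurable_vector_matrix_mult [measurable (raw)]: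
  fixes A :: "'w \<Rightarrow> real ^ 'n ^ 'm"
  assumes [measurable]: "A \<in> borel_measurable M" "x \<in> borel_measurable M"
  shows "(\<lambda>w. x w v* A w) \<in> borel_measurable M"
  by (rule borel_measurable_vecI) (simp add: vector_matrix_mult_def)

lemma borel_measurable_transpose [measurable (raw)]:
  fixes A :: "'w \<Rightarrow> real ^ 'n ^ 'm"
  assumes [measurable]: "A \<in> borel_measurable M"
  shows "(\<lambda>w. transpose (A w)) \<in> borel_measurable M"
  by (intro borel_measurable_vecI) (simp add: transpose_def)

lemma borel_measurable_matrix_matrix_mult [measurable (raw)]:
  fixes A :: "'w \<Rightarrow> real ^ 'n ^ 'm" and B :: "'w \<Rightarrow> real ^ 'k ^ 'n"
  assumes [measurable]: "A \<in> borel_measurable M" "B \<in> borel_measurable M"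
  shows "(\<lambda>w. A w ** B w) \<in> borel_measurable M"
  by (intro borel_measurable_vecI) (simp add: matrix_matrix_mult_def)

lemma borel_measurable_det [measurable (raw)]:
  fixes A :: "'w \<Rightarrow> real ^ 'n ^ 'n"
  assumes [measurable]: "A \<in> borel_measurable M"
  shows "(\<lambda>w. det (A w)) \<in> borel_measurable M"
  unfolding det_def by measurable

text \<open>By Cramer's rule the solution is a rational function of the coefficients.\<close>

lemma linear_system_solution_measurable:
  fixes A :: "'w \<Rightarrow> real ^ 'n ^ 'n"
  assumes A[measurable]: "A \<in> borel_measurable M" and b[measurable]: "b \<in> borel_measurable M"
    and inj: "\<And>w. w \<in> space M \<Longrightarrow> det (A w) \<noteq> 0"
    and sol: "\<And>w. w \<in> space M \<Longrightarrow> A w *v x w = b w"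
  shows "x \<in> borel_measurable M"
proof -
  have "(\<lambda>w. (\<chi> k. det (\<chi> i j. if j = k then b w $ i else A w $ i $ j) / det (A w)) :: real^'n) \<in> borel_measurable M"
  proof (rule borel_measurable_vecI)
    fix k
    have "(\<lambda>w. (\<chi> i j. if j = k then b w $ i else A w $ i $ j) :: real^'n^'n) \<in> borel_measurable M"
      by (intro borel_measurable_vecI) simp
    then show "(\<lambda>w. (\<chi> k. det (\<chi> i j. if j = k then b w $ i else A w $ i $ j) / det (A w)) $ k) \<in> borel_measurable M"
      by simp
  qed
  then show ?thesis
    by (rule measurable_cong[THEN iffD2, rotated]) (use cramer inj sol in blast)
qed

lemma linear_matrix_vector_mult: "linear ((*v) A)" for A :: "real^'n^'m"
  by (rule matrix_vector_mul_linear)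

lemma subspace_linear_family_vimage:
  assumes f: "\<And>i. linear (f i)" and L: "\<And>i. subspace (L i)"
  shows "subspace {x. \<forall>i. f i x \<in> L i}"
proof -
  have "{x. \<forall>i. f i x \<in> L i} = (\<Inter>i. f i -` L i)" by auto
  then show ?thesis using linear_subspace_vimage[OF f L] by (simp add: subspace_Inter)
qed

text \<open>The subspace is the kernel of the positive semidefinite map that sends \<open>x\<close> to the sum of the
\<open>transpose (F i w) *v R i (F i w *v x)\<close>, where \<open>R i\<close> is the projection to the orthogonal complement of
\<open>L i\<close>. So the projection is a limit of solutions of linear systems, and this works equally well at
those \<open>w\<close> where the dimension of the subspace jumps.\<close>

lemma measurable_oproj_vimage:
  fixes F :: "'i::finite \<Rightarrow> 'w \<Rightarrow> real ^ 'n ^ 'm"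
  assumes F[measurable]: "\<And>i. F i \<in> borel_measurable M" and g[measurable]: "g \<in> borel_measurable M"
    and L: "\<And>i. subspace (L i)"
  shows "(\<lambda>w. oproj {x. \<forall>i. F i w *v x \<in> L i} (g w)) \<in> borel_measurable M"
proof -
  define R where "R i v = v - oproj (L i) v" for i :: 'i and v
  have linR: "linear (R i)" for i
    using linear_oproj[OF L, of i] unfolding R_def by (intro linear_compose_sub linear_id[unfolded id_def])
  have R0: "R i v = 0 \<longleftrightarrow> v \<in> L i" for i v
    using oproj_mem[OF L, of i v] oproj_ident[OF L, of v i] by (auto simp: R_def)
  have RR: "u \<bullet> R i v = R i u \<bullet> R i v" for i u v
  proof -
    have "R i v \<bullet> oproj (L i) u = 0" unfolding R_def by (rule oproj_orthogonal[OF L oproj_mem[OF L]])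
    then have "oproj (L i) u \<bullet> R i v = 0" by (simp add: inner_commute)
    moreover have "u = R i u + oproj (L i) u" by (simp add: R_def)
    then have "u \<bullet> R i v = R i u \<bullet> R i v + oproj (L i) u \<bullet> R i v" by (metis inner_add_left)
    ultimately show ?thesis by simp
  qed
  note [measurable] = borel_measurable_linear[OF linR]
  define B where "B w x = (\<Sum>i\<in>UNIV. transpose (F i w) *v R i (F i w *v x))" for w x
  have linB: "linear (B w)" for w
    unfolding B_def
    by (intro linear_compose_sum ballI linear_compose[of "\<lambda>x. R _ (F _ w *v x)" "(*v) _", unfolded o_def]
        linear_compose[of "(*v) _" "R _", unfolded o_def] linR linear_matrix_vector_mult)
  have xB: "x \<bullet> B w y = (\<Sum>i\<in>UNIV. R i (F i w *v x) \<bullet> R i (F i w *v y))" for x y w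
  proof -
    have "x \<bullet> (transpose (F i w) *v v) = (F i w *v x) \<bullet> v" for i v
      by (metis dot_lmul_matrix inner_commute vector_transpose_matrix)
    then show ?thesis unfolding B_def inner_sum_right by (simp add: RR[symmetric] flip: RR)
  qed
  have sym: "x \<bullet> B w y = B w x \<bullet> y" for x y w
    by (subst inner_commute[of "B w x"]) (simp add: xB inner_commute)
  have psd: "0 \<le> x \<bullet> B w x" for x w unfolding xB by (intro sum_nonneg) simp
  have ker: "B w x = 0 \<longleftrightarrow> (\<forall>i. F i w *v x \<in> L i)" for w x
  proof
    assume "B w x = 0"
    then have "(\<Sum>i\<in>UNIV. R i (F i w *v x) \<bullet> R i (F i w *v x)) = 0" by (simp flip: xB)
    then have "\<forall>i\<in>UNIV. R i (F i w *v x) \<bullet> R i (F i w *v x) = 0" by (subst (asm) sum_nonneg_eq_0_iff) auto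
    then show "\<forall>i. F i w *v x \<in> L i" by (simp add: R0)
  next
    assume "\<forall>i. F i w *v x \<in> L i"
    then have "R i (F i w *v x) = 0" for i by (simp add: R0)
    then show "B w x = 0" by (simp add: B_def)
  qed
  define A where "A n w = matrix (\<lambda>x. x + real n *\<^sub>R B w x)" for n :: nat and w
  have linA: "linear (\<lambda>x. x + real n *\<^sub>R B w x)" for n w
    by (intro linear_compose_add linear_compose_scale_right linB linear_id[unfolded id_def])
  have A: "A n w *v x = x + real n *\<^sub>R B w x" for n w x
    unfolding A_def by (rule fun_cong[OF matrix_vector_mul(2)[OF linA]])
  have detA: "det (A n w) \<noteq> 0" for n w
  proof -
    have "x = 0" if "A n w *v x = 0" for x
    proof -
      have "0 = x \<bullet> x + real n * (x \<bullet> B w x)" using that by (metis A inner_add_right inner_scaleR_right inner_zero_right)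
      then have "x \<bullet> x \<le> 0" using psd[of x w] by (smt (verit) mult_nonneg_nonneg of_nat_0_le_iff)
      then show "x = 0" by (metis inner_ge_zero inner_eq_zero_iff order_antisym)
    qed
    then have "invertible (A n w)"
      unfolding invertible_left_inverse matrix_left_invertible_ker by blast
    then show ?thesis by (simp add: invertible_det_nz)
  qed
  have measA[measurable]: "A n \<in> borel_measurable M" for n
    by (intro borel_measurable_vecI) (simp add: A_def matrix_def B_def)
  define y where "y n w = (SOME v. A n w *v v = g w)" for n w
  have y: "A n w *v y n w = g w" for n w
  proof -
    have "invertible (A n w)" using detA by (simp add: invertible_det_nz)
    then obtain A' where "A n w ** A' = mat 1" unfolding invertible_def by blast
    then have "A n w *v (A' *v g w) = g w" by (simp add: matrix_vector_mul_assoc)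
    then show ?thesis unfolding y_def by (rule someI)
  qed
  have ym: "y n \<in> borel_measurable M" for n
    by (rule linear_system_solution_measurable[OF measA[of n] g]) (simp_all add: detA y)
  have lim: "(\<lambda>n. y n w) \<longlonglongrightarrow> oproj {x. \<forall>i. F i w *v x \<in> L i} (g w)" for w
    using resolvent_tendsto_oproj_kernel[OF linB sym psd, of "\<lambda>n. y n w" w "g w"] y
    by (simp add: ker A)
  show ?thesis
    by (rule borel_measurable_LIMSEQ_metric[of y, OF ym lim])
qed

lemma measurable_dim_vimage:
  fixes F :: "'i::finite \<Rightarrow> 'w \<Rightarrow> real ^ 'n ^ 'm"
  assumes F[measurable]: "\<And>i. F i \<in> borel_measurable M" and L: "\<And>i. subspace (L i)"
  shows "(\<lambda>w. real (dim {x. \<forall>i. F i w *v x \<in> L i})) \<in> borel_measurable M"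
proof -
  have sK: "subspace {x. \<forall>i. F i w *v x \<in> L i}" for w
    by (rule subspace_linear_family_vimage[OF linear_matrix_vector_mult L])
  have "(\<lambda>w. oproj {x. \<forall>i. F i w *v x \<in> L i} e) \<in> borel_measurable M" for e
    by (rule measurable_oproj_vimage[OF F _ L]) auto
  then show ?thesis unfolding dim_eq_sum_oproj[OF sK] by measurable
qed

section \<open>Lineality spaces and strata of polyhedral cones\<close>

text \<open>For a point \<open>x\<close> of a polyhedral cone this is the span of the smallest face that contains \<open>x\<close>.\<close>

definition lineality :: "'a::euclidean_space set \<Rightarrow> 'a \<Rightarrow> 'a set" where
  "lineality D x = {v. \<exists>e>0. x + e *\<^sub>R v \<in> D \<and> x - e *\<^sub>R v \<in> D}"

text \<open>A constraint that is strict at \<open>x\<close> survives a small step, and one that is active at \<open>x\<close> survives a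
step in both senses only if the direction lies in its boundary hyperplane.\<close>

lemma lineality_halfspaces:
  assumes A: "finite A" and x: "\<forall>a\<in>A. a \<bullet> x \<le> 0"
  shows "lineality {x. \<forall>a\<in>A. a \<bullet> x \<le> 0} x = {v. \<forall>a\<in>A. a \<bullet> x = 0 \<longrightarrow> a \<bullet> v = 0}" (is "?L = ?R")
proof (intro set_eqI iffI)
  fix v assume "v \<in> ?L"
  then obtain e where e: "e > 0" "\<And>a. a \<in> A \<Longrightarrow> a \<bullet> (x + e *\<^sub>R v) \<le> 0 \<and> a \<bullet> (x - e *\<^sub>R v) \<le> 0"
    by (auto simp: lineality_def)
  have "a \<bullet> v = 0" if "a \<in> A" "a \<bullet> x = 0" for a
    using e(2)[OF that(1)] e(1) that(2) by (auto simp: inner_simps mult_le_0_iff zero_le_mult_iff)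
  then show "v \<in> ?R" by auto
next
  fix v assume v: "v \<in> ?R"
  have "\<forall>\<^sub>F e in at_right 0. a \<bullet> (x + e *\<^sub>R v) \<le> 0 \<and> a \<bullet> (x - e *\<^sub>R v) \<le> 0" if "a \<in> A" for a
  proof (cases "a \<bullet> x = 0")
    case True
    then show ?thesis using v that by (simp add: inner_simps)
  next
    case False
    then have neg: "a \<bullet> x < 0" using x that by force
    have "((\<lambda>e. a \<bullet> (x + e *\<^sub>R v)) \<longlongrightarrow> a \<bullet> (x + 0 *\<^sub>R v)) (at_right 0)"
      "((\<lambda>e. a \<bullet> (x - e *\<^sub>R v)) \<longlongrightarrow> a \<bullet> (x - 0 *\<^sub>R v)) (at_right 0)"
      by (intro tendsto_intros)+
    from order_tendstoD(2)[OF this(1), of 0] order_tendstoD(2)[OF this(2), of 0] neg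
    show ?thesis by (simp add: eventually_conj_iff) (meson eventually_mono less_imp_le)
  qed
  then have "\<forall>\<^sub>F e in at_right (0::real). \<forall>a\<in>A. a \<bullet> (x + e *\<^sub>R v) \<le> 0 \<and> a \<bullet> (x - e *\<^sub>R v) \<le> 0"
    using A by (simp add: eventually_ball_finite)
  then have "\<forall>\<^sub>F e in at_right (0::real). e > 0 \<and> (\<forall>a\<in>A. a \<bullet> (x + e *\<^sub>R v) \<le> 0 \<and> a \<bullet> (x - e *\<^sub>R v) \<le> 0)"
    by (simp add: eventually_conj_iff eventually_at_right_less)
  then obtain e where "e > 0 \<and> (\<forall>a\<in>A. a \<bullet> (x + e *\<^sub>R v) \<le> 0 \<and> a \<bullet> (x - e *\<^sub>R v) \<le> 0)"
    using eventually_happens trivial_limit_at_right_real by blast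
  then show "v \<in> ?L" by (auto simp: lineality_def)
qed

text \<open>For a polyhedral cone, this is the relative interior of the face with span \<open>L\<close> if there is such a
face, and empty otherwise.\<close>

definition stratum :: "'a::euclidean_space set \<Rightarrow> 'a set \<Rightarrow> 'a set" where
  "stratum D L = {x\<in>D. lineality D x = L}"

lemma subspace_lineality:
  assumes "polyhedral_cone D" "x \<in> D"
  shows "subspace (lineality D x)"
proof -
  obtain A where A: "finite A" "D = {x. \<forall>a\<in>A. a \<bullet> x \<le> 0}" using assms(1) unfolding polyhedral_cone_def by blast
  show ?thesis using assms(2) unfolding A(2)
    by (subst lineality_halfspaces) (auto simp: A(1) subspace_def inner_simps)
qed

lemma mem_lineality:
  assumes "polyhedral_cone D" "x \<in> D"
  shows "x \<in> lineality D x"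
proof -
  obtain A where A: "finite A" "D = {x. \<forall>a\<in>A. a \<bullet> x \<le> 0}" using assms(1) unfolding polyhedral_cone_def by blast
  show ?thesis using assms(2) unfolding A(2)
    by (subst lineality_halfspaces) (auto simp: A(1))
qed

lemma finite_lineality:
  assumes "polyhedral_cone D"
  shows "finite (lineality D ` D)"
proof -
  obtain A where A: "finite A" "D = {x. \<forall>a\<in>A. a \<bullet> x \<le> 0}" using assms(1) unfolding polyhedral_cone_def by blast
  have "lineality D x = {v. \<forall>a\<in>{a\<in>A. a \<bullet> x = 0}. a \<bullet> v = 0}" if "x \<in> D" for x
    using that unfolding A(2) by (subst lineality_halfspaces) (auto simp: A(1))
  then have "lineality D ` D \<subseteq> (\<lambda>I. {v. \<forall>a\<in>I. a \<bullet> v = 0}) ` Pow A"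
    by (intro image_subsetI) (rule image_eqI, assumption, blast)
  then show ?thesis by (rule finite_subset) (simp add: A(1))
qed

text \<open>In a given face, a point with the fewest active constraints lies in the relative interior, and its
lineality space is the span of the face. Conversely, the sum of the constraints active at \<open>x\<close> is the
normal vector of a supporting hyperplane that cuts out the smallest face containing \<open>x\<close>.\<close>

lemma face_spans_eq_lineality:
  assumes D: "polyhedral_cone D"
  shows "face_spans k D = {L \<in> lineality D ` D. dim L = k}"
proof -
  obtain A where A: "finite A" "D = {x. \<forall>a\<in>A. a \<bullet> x \<le> 0}" using assms(1) unfolding polyhedral_cone_def by blast
  have lin: "lineality D x = {v. \<forall>a\<in>A. a \<bullet> x = 0 \<longrightarrow> a \<bullet> v = 0}" if "x \<in> D" for x
    using that unfolding A(2) by (intro lineality_halfspaces) (auto simp: A(1))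
  have "(\<exists>F. cone_face F D \<and> L = span F) \<longleftrightarrow> L \<in> lineality D ` D" for L
  proof
    assume "\<exists>F. cone_face F D \<and> L = span F"
    then obtain z where z: "\<And>x. x \<in> D \<Longrightarrow> x \<bullet> z \<le> 0" and L: "L = span {x\<in>D. x \<bullet> z = 0}"
      by (auto simp: cone_face_def)
    define F where "F = {x\<in>D. x \<bullet> z = 0}"
    define I where "I x = {a\<in>A. a \<bullet> x = 0}" for x
    have "0 \<in> F" by (simp add: F_def A(2))
    then obtain x where x: "x \<in> F" and min: "\<And>y. y \<in> F \<Longrightarrow> card (I x) \<le> card (I y)"
      using ex_has_least_nat[of "\<lambda>x. x \<in> F" 0 "\<lambda>x. card (I x)"] by auto
    have xD: "x \<in> D" using x by (simp add: F_def)
    have sub: "I x \<subseteq> I y" if y: "y \<in> F" for y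
    proof -
      have "x + y \<in> F" using x y by (fastforce simp: F_def A(2) inner_simps)
      moreover have "I (x + y) \<subseteq> I x \<inter> I y"
      proof -
        have "a \<bullet> x = 0 \<and> a \<bullet> y = 0" if "a \<in> A" "a \<bullet> (x + y) = 0" for a
        proof -
          have "a \<bullet> x \<le> 0" "a \<bullet> y \<le> 0" using that x y by (auto simp: F_def A(2))
          then show ?thesis using that by (simp add: inner_simps)
        qed
        then show ?thesis by (auto simp: I_def)
      qed
      ultimately have "card (I x) \<le> card (I x \<inter> I y)"
        using min[of "x + y"] card_mono[of "I x \<inter> I y" "I (x + y)"] A(1) by (force simp: I_def)
      then have "I x \<inter> I y = I x"
        using A(1) by (intro card_seteq) (auto simp: I_def)
      then show ?thesis by auto
    qed
    have "span F = lineality D x"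
    proof
      show "span F \<subseteq> lineality D x"
      proof (rule span_minimal)
        show "F \<subseteq> lineality D x" using sub by (auto simp: lin[OF xD] I_def)
      qed (rule subspace_lineality[OF D xD])
      show "lineality D x \<subseteq> span F"
      proof
        fix v assume "v \<in> lineality D x"
        then obtain e where e: "e > 0" "x + e *\<^sub>R v \<in> D" "x - e *\<^sub>R v \<in> D" by (auto simp: lineality_def)
        have "(x + e *\<^sub>R v) \<bullet> z \<le> 0" "(x - e *\<^sub>R v) \<bullet> z \<le> 0" using e z by auto
        moreover have "x \<bullet> z = 0" using x by (simp add: F_def)
        ultimately have "v \<bullet> z = 0" using e(1) by (auto simp: inner_simps mult_le_0_iff zero_le_mult_iff)
        then have "x + e *\<^sub>R v \<in> F" using \<open>x \<bullet> z = 0\<close> e by (simp add: F_def inner_simps)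
        then have "(1/e) *\<^sub>R ((x + e *\<^sub>R v) - x) \<in> span F" using x
          by (intro span_mul span_diff span_base) auto
        then show "v \<in> span F" using e(1) by simp
      qed
    qed
    then show "L \<in> lineality D ` D" using xD L by (auto simp: F_def)
  next
    assume "L \<in> lineality D ` D"
    then obtain x where x: "x \<in> D" "L = lineality D x" by auto
    define z where "z = (\<Sum>a\<in>{a\<in>A. a \<bullet> x = 0}. a)"
    have yz: "y \<bullet> z = (\<Sum>a\<in>{a\<in>A. a \<bullet> x = 0}. a \<bullet> y)" for y
      by (simp add: z_def inner_sum_right inner_commute)
    have F: "{y\<in>D. y \<bullet> z = 0} = D \<inter> L"
    proof -
      have "y \<bullet> z = 0 \<longleftrightarrow> (\<forall>a\<in>{a\<in>A. a \<bullet> x = 0}. a \<bullet> y = 0)" if "y \<in> D" for y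
      proof -
        have "y \<bullet> z = 0 \<longleftrightarrow> (\<Sum>a\<in>{a\<in>A. a \<bullet> x = 0}. - (a \<bullet> y)) = 0"
          by (simp add: yz sum_negf)
        also have "\<dots> \<longleftrightarrow> (\<forall>a\<in>{a\<in>A. a \<bullet> x = 0}. - (a \<bullet> y) = 0)"
          using A that by (intro sum_nonneg_eq_0_iff) auto
        finally show ?thesis by simp
      qed
      then show ?thesis unfolding x(2) lin[OF x(1)] by blast
    qed
    have "\<forall>y\<in>D. y \<bullet> z \<le> 0" unfolding yz by (auto simp: A(2) intro: sum_nonpos)
    then have "cone_face (D \<inter> L) D" unfolding cone_face_def F[symmetric] by blast
    moreover have "L = span (D \<inter> L)"
    proof
      have sL: "subspace L" using subspace_lineality D x by blast
      show "span (D \<inter> L) \<subseteq> L" by (rule span_minimal) (use sL in auto)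
      show "L \<subseteq> span (D \<inter> L)"
      proof
        fix v assume v: "v \<in> L"
        then obtain e where e: "e > 0" "x + e *\<^sub>R v \<in> D" by (auto simp: lineality_def x(2))
        have xL: "x \<in> L" using mem_lineality D x by blast
        have "x + e *\<^sub>R v \<in> D \<inter> L" using e v xL sL by (auto intro: subspace_add subspace_mul)
        then have "(1/e) *\<^sub>R ((x + e *\<^sub>R v) - x) \<in> span (D \<inter> L)" using x(1) xL
          by (intro span_mul span_diff span_base) auto
        then show "v \<in> span (D \<inter> L)" using e(1) by simp
      qed
    qed
    ultimately show "\<exists>F. cone_face F D \<and> L = span F" by blast
  qed
  moreover have "face_spans k D = {L. (\<exists>F. cone_face F D \<and> L = span F) \<and> dim L = k}"
    unfolding face_spans_def by auto
  ultimately show ?thesis by presburger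
qed

lemma stratum_eq:
  assumes A: "finite A" and D: "D = {x. \<forall>a\<in>A. a \<bullet> x \<le> 0}" and x0: "x0 \<in> D"
  shows "stratum D (lineality D x0) =
    (D \<inter> lineality D x0) - (\<Union>a\<in>{a\<in>A. a \<bullet> x0 \<noteq> 0}. {x. a \<bullet> x = 0})"
proof -
  have lin: "lineality D x = {v. \<forall>a\<in>A. a \<bullet> x = 0 \<longrightarrow> a \<bullet> v = 0}" if "x \<in> D" for x
    using that unfolding D by (intro lineality_halfspaces) (auto simp: A(1))
  have "polyhedral_cone D" unfolding polyhedral_cone_def using A D by blast
  have "lineality D x = lineality D x0 \<longleftrightarrow>
     x \<in> lineality D x0 \<and> (\<forall>a\<in>A. a \<bullet> x0 \<noteq> 0 \<longrightarrow> a \<bullet> x \<noteq> 0)" if x: "x \<in> D" for x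
  proof
    assume eq: "lineality D x = lineality D x0"
    have "x \<in> lineality D x0" "x0 \<in> lineality D x"
      using mem_lineality[OF \<open>polyhedral_cone D\<close>] x x0 eq by auto
    then show "x \<in> lineality D x0 \<and> (\<forall>a\<in>A. a \<bullet> x0 \<noteq> 0 \<longrightarrow> a \<bullet> x \<noteq> 0)"
      unfolding lin[OF x] lin[OF x0] by blast
  next
    assume "x \<in> lineality D x0 \<and> (\<forall>a\<in>A. a \<bullet> x0 \<noteq> 0 \<longrightarrow> a \<bullet> x \<noteq> 0)"
    then show "lineality D x = lineality D x0"
      unfolding lin[OF x] lin[OF x0] by blast
  qed
  then show ?thesis unfolding stratum_def by blast
qed

text \<open>The constraints of the preimage are the images of the constraints of the \<open>C i\<close> under the adjoints of
the \<open>f i\<close>, and corresponding constraints are active at corresponding points.\<close>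

lemma polyhedral_cone_vimage:
  fixes f :: "'i::finite \<Rightarrow> 'a::euclidean_space \<Rightarrow> 'b::euclidean_space"
  assumes f: "\<And>i. linear (f i)" and C: "\<And>i. polyhedral_cone (C i)"
  shows "polyhedral_cone {x. \<forall>i. f i x \<in> C i}"
    and "(\<And>i. f i x \<in> C i) \<Longrightarrow> lineality {x. \<forall>i. f i x \<in> C i} x = {v. \<forall>i. f i v \<in> lineality (C i) (f i x)}"
proof -
  obtain A where A: "\<And>i. finite (A i)" "\<And>i. C i = {x. \<forall>a\<in>A i. a \<bullet> x \<le> 0}"
  proof -
    have "\<forall>i. \<exists>A. finite A \<and> C i = {x. \<forall>a\<in>A. a \<bullet> x \<le> 0}"
      using C by (simp add: polyhedral_cone_def)
    from choice[OF this] show ?thesis using that by blast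
  qed
  define B where "B = (\<Union>i. adjoint (f i) ` A i)"
  have fB: "finite B" using A(1) by (simp add: B_def)
  have B: "(\<forall>b\<in>B. Q b) \<longleftrightarrow> (\<forall>i. \<forall>a\<in>A i. Q (adjoint (f i) a))" for Q by (auto simp: B_def)
  have adj: "adjoint (f i) a \<bullet> x = a \<bullet> f i x" for i a x using adjoint_clauses(2)[OF f] .
  have D: "{x. \<forall>i. f i x \<in> C i} = {x. \<forall>b\<in>B. b \<bullet> x \<le> 0}"
    unfolding B adj by (simp add: A(2))
  show "polyhedral_cone {x. \<forall>i. f i x \<in> C i}"
    unfolding polyhedral_cone_def by (intro exI[of _ B] conjI fB D)
  assume x: "\<And>i. f i x \<in> C i"
  then have "x \<in> {x. \<forall>i. f i x \<in> C i}" by simp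
  then have Bx: "\<forall>b\<in>B. b \<bullet> x \<le> 0" unfolding D by simp
  have "lineality (C i) (f i x) = {v. \<forall>a\<in>A i. a \<bullet> f i x = 0 \<longrightarrow> a \<bullet> v = 0}" for i
    using x[of i] unfolding A(2) by (intro lineality_halfspaces A(1)) simp
  then show "lineality {x. \<forall>i. f i x \<in> C i} x = {v. \<forall>i. f i v \<in> lineality (C i) (f i x)}"
    unfolding D lineality_halfspaces[OF fB Bx] unfolding B adj by simp
qed

lemma closed_polyhedral_cone:
  assumes "polyhedral_cone D"
  shows "closed D"
proof -
  obtain A where A: "D = {x. \<forall>a\<in>A. a \<bullet> x \<le> 0}" using assms by (auto simp: polyhedral_cone_def)
  have "D = (\<Inter>a\<in>A. {x. a \<bullet> x \<le> 0})" by (auto simp: A)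
  then show ?thesis by (simp add: closed_INT closed_halfspace_le)
qed

lemma stratum_borel:
  assumes "polyhedral_cone D" "L \<in> lineality D ` D"
  shows "stratum D L \<in> sets borel"
proof -
  obtain A where A: "finite A" "D = {x. \<forall>a\<in>A. a \<bullet> x \<le> 0}" using assms(1) unfolding polyhedral_cone_def by blast
  obtain x0 where x0: "x0 \<in> D" "L = lineality D x0" using assms(2) by blast
  have "closed D" "closed L"
    using closed_polyhedral_cone assms closed_subspace subspace_lineality by auto
  then show ?thesis unfolding x0(2) stratum_eq[OF A x0(1)]
    using A(1) by (intro sets.Diff sets.Int sets.finite_UN) (auto simp: x0 closed_hyperplane)
qed

lemma stratum_conic:
  assumes "polyhedral_cone D" "L \<in> lineality D ` D" "c > 0" "x \<in> stratum D L"
  shows "c *\<^sub>R x \<in> stratum D L"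
proof -
  obtain A where A: "finite A" "D = {x. \<forall>a\<in>A. a \<bullet> x \<le> 0}" using assms(1) unfolding polyhedral_cone_def by blast
  obtain x0 where x0: "x0 \<in> D" "L = lineality D x0" using assms(2) by blast
  have "subspace L" using x0 subspace_lineality assms by auto
  then show ?thesis using assms(3,4) unfolding x0(2) stratum_eq[OF A x0(1)]
    by (auto simp: A(2) mult_le_0_iff subspace_mul)
qed

section \<open>Polyhedral measures as sums over strata\<close>

text \<open>The points of the face outside of the stratum lie in finitely many proper hyperplanes of \<open>L\<close>.\<close>

lemma measure_gaussian_on_stratum:
  assumes D: "polyhedral_cone D" and L: "L \<in> lineality D ` D" and M: "M \<in> sets borel"
  shows "measure (gaussian_on L) (D \<inter> L \<inter> M) = measure (gaussian_on L) (stratum D L \<inter> M)"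
proof -
  obtain A where A: "finite A" "D = {x. \<forall>a\<in>A. a \<bullet> x \<le> 0}" using D unfolding polyhedral_cone_def by blast
  obtain x0 where x0: "x0 \<in> D" "L = lineality D x0" using L by blast
  have sL: "subspace L" using x0 subspace_lineality[OF D] by blast
  interpret G: prob_space "gaussian_on L" by (rule prob_space_gaussian_on[OF sL])
  have "AE x in gaussian_on L. a \<bullet> x \<noteq> 0" if a: "a \<in> A" "a \<bullet> x0 \<noteq> 0" for a
  proof -
    have x0L: "x0 \<in> L" using mem_lineality[OF D] x0 by blast
    have eq: "oproj L a \<bullet> x = a \<bullet> x" if "x \<in> L" for x
      using inner_oproj[OF sL that, of a] by (simp add: inner_commute)
    then have "oproj L a \<noteq> 0" using a(2) x0L by force
    from AE_gaussian_on_hyperplane[OF sL oproj_mem[OF sL] this] AE_gaussian_on_mem[OF sL]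
    show ?thesis by eventually_elim (simp add: eq)
  qed
  then have "AE x in gaussian_on L. \<forall>a\<in>{a\<in>A. a \<bullet> x0 \<noteq> 0}. a \<bullet> x \<noteq> 0"
    using A(1) by (intro AE_finite_allI) auto
  then have "AE x in gaussian_on L. x \<in> D \<inter> L \<inter> M \<longleftrightarrow> x \<in> stratum D L \<inter> M"
    unfolding x0(2) stratum_eq[OF A x0(1)] by eventually_elim blast
  moreover have "D \<in> sets borel" "L \<in> sets borel"
    using closed_polyhedral_cone[OF D] closed_subspace[OF sL] by auto
  ultimately show ?thesis
    using M stratum_borel[OF D L] by (intro G.finite_measure_eq_AE) (auto simp: sets_gaussian_on[OF sL])
qed

lemma polyhedral_measure_eq_strata:
  assumes D: "polyhedral_cone D" and M: "M \<in> sets borel"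
  shows "polyhedral_measure k D M
    = (\<Sum>L\<in>{L \<in> lineality D ` D. dim L = k}. measure (gaussian_on L) (stratum D L \<inter> M))"
  unfolding polyhedral_measure_def face_spans_eq_lineality[OF D]
  by (intro sum.cong refl measure_gaussian_on_stratum[OF D _ M]) auto

definition lineality_tuples :: "('i::finite \<Rightarrow> 'a::euclidean_space set) \<Rightarrow> ('i \<Rightarrow> 'a set) set" where
  "lineality_tuples C = {L. \<forall>i. L i \<in> lineality (C i) ` C i}"

lemma finite_lineality_tuples:
  assumes "\<And>i. polyhedral_cone (C i)"
  shows "finite (lineality_tuples C)"
proof -
  have "lineality_tuples C = PiE UNIV (\<lambda>i. lineality (C i) ` C i)"
    by (auto simp: lineality_tuples_def PiE_def Pi_def)
  then show ?thesis using finite_lineality[OF assms] by (simp add: finite_PiE)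
qed

lemma subspace_lineality_tuples:
  assumes "\<And>i. polyhedral_cone (C i)" "L \<in> lineality_tuples C"
  shows "subspace (L i)"
proof -
  obtain x where "x \<in> C i" "L i = lineality (C i) x" using assms(2) unfolding lineality_tuples_def by blast
  then show ?thesis using subspace_lineality[OF assms(1)] by simp
qed

text \<open>The common preimages of strata, one of each \<open>C i\<close>, partition the cone on the left and refine its
stratification. In special position several tuples \<open>L\<close> can yield the same span \<open>K\<close>; their contributions
are then the masses of disjoint parts of one stratum, so the identity holds in every position.\<close>

lemma polyhedral_measure_vimage:
  fixes f :: "'i::finite \<Rightarrow> 'a::euclidean_space \<Rightarrow> 'b::euclidean_space"
  assumes f: "\<And>i. linear (f i)" and C: "\<And>i. polyhedral_cone (C i)" and M: "\<And>i. M i \<in> sets borel"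
  shows "polyhedral_measure k {x. \<forall>i. f i x \<in> C i} {x. \<forall>i. f i x \<in> M i} =
    (\<Sum>L\<in>{L\<in>lineality_tuples C. dim {x. \<forall>i. f i x \<in> L i} = k}.
       measure (gaussian_on {x. \<forall>i. f i x \<in> L i}) {x. \<forall>i. f i x \<in> stratum (C i) (L i) \<inter> M i})"
proof -
  define D where "D = {x. \<forall>i. f i x \<in> C i}"
  define N where "N = {x. \<forall>i. f i x \<in> M i}"
  define K where "K L = {x. \<forall>i. f i x \<in> L i}" for L :: "'i \<Rightarrow> 'b set"
  define S where "S L = {x. \<forall>i. f i x \<in> stratum (C i) (L i) \<inter> M i}" for L :: "'i \<Rightarrow> 'b set"
  have D: "polyhedral_cone D" unfolding D_def by (rule polyhedral_cone_vimage(1)[OF f C])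
  note [measurable] = borel_measurable_linear[OF f]
  have Nm: "N \<in> sets borel"
  proof -
    have "{x\<in>space borel. \<forall>i. f i x \<in> M i} \<in> sets borel" using M by measurable
    then show ?thesis by (simp add: N_def)
  qed
  have Sm: "S L \<in> sets borel" if "L \<in> lineality_tuples C" for L
  proof -
    have "stratum (C i) (L i) \<inter> M i \<in> sets borel" for i
      using stratum_borel[OF C] that M by (auto simp: lineality_tuples_def)
    then have "{x\<in>space borel. \<forall>i. f i x \<in> stratum (C i) (L i) \<inter> M i} \<in> sets borel" by measurable
    then show ?thesis by (simp add: S_def)
  qed
  have SK: "lineality D x = K L" "x \<in> D" if "x \<in> S L" for x L
  proof -
    have x: "f i x \<in> C i" "lineality (C i) (f i x) = L i" for i using that by (auto simp: S_def stratum_def)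
    show "x \<in> D" using x by (simp add: D_def)
    show "lineality D x = K L"
      unfolding D_def K_def using polyhedral_cone_vimage(2)[of f C x, OF f C x(1)] x(2) by simp
  qed
  have stratum: "stratum D \<Lambda> \<inter> N = (\<Union>L\<in>{L\<in>lineality_tuples C. K L = \<Lambda>}. S L)" for \<Lambda>
  proof (intro set_eqI iffI)
    fix x assume x: "x \<in> stratum D \<Lambda> \<inter> N"
    define L where "L i = lineality (C i) (f i x)" for i
    have "x \<in> S L" using x by (auto simp: S_def stratum_def N_def L_def D_def)
    moreover from this have "K L = \<Lambda>" using SK[of x L] x by (simp add: stratum_def)
    moreover have "L \<in> lineality_tuples C" using x by (auto simp: lineality_tuples_def L_def stratum_def D_def)
    ultimately show "x \<in> (\<Union>L\<in>{L\<in>lineality_tuples C. K L = \<Lambda>}. S L)" by blast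
  next
    fix x assume "x \<in> (\<Union>L\<in>{L\<in>lineality_tuples C. K L = \<Lambda>}. S L)"
    then obtain L where L: "K L = \<Lambda>" "x \<in> S L" by blast
    then show "x \<in> stratum D \<Lambda> \<inter> N" using SK[OF L(2)] by (auto simp: stratum_def S_def N_def)
  qed
  have disj: "disjoint_family_on S X" for X
  proof -
    have "L = L'" if "x \<in> S L" "x \<in> S L'" for x L L'
      using that by (auto simp: S_def stratum_def fun_eq_iff)
    then show ?thesis unfolding disjoint_family_on_def by blast
  qed
  have sub: "subspace (K L)" if "L \<in> lineality_tuples C" for L
    unfolding K_def using subspace_lineality_tuples[OF C that] by (intro subspace_linear_family_vimage f)
  define T where "T = {L\<in>lineality_tuples C. dim (K L) = k}"
  define R where "R = {\<Lambda> \<in> lineality D ` D. dim \<Lambda> = k}"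
  have finT: "finite T" "finite (lineality_tuples C)" using finite_lineality_tuples[of C, OF C] by (auto simp: T_def)
  have finR: "finite R" using finite_lineality[OF D] by (simp add: R_def)
  have "polyhedral_measure k D N = (\<Sum>\<Lambda>\<in>R. measure (gaussian_on \<Lambda>) (stratum D \<Lambda> \<inter> N))"
    unfolding R_def by (rule polyhedral_measure_eq_strata[OF D Nm])
  also have "\<dots> = (\<Sum>\<Lambda>\<in>R. \<Sum>L\<in>{L\<in>{L\<in>T. K L \<in> R}. K L = \<Lambda>}. measure (gaussian_on (K L)) (S L))"
  proof (rule sum.cong[OF refl])
    fix \<Lambda> assume \<Lambda>: "\<Lambda> \<in> R"
    then have s\<Lambda>: "subspace \<Lambda>" using subspace_lineality[OF D] by (auto simp: R_def)
    interpret G: prob_space "gaussian_on \<Lambda>" by (rule prob_space_gaussian_on[OF s\<Lambda>])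
    have "measure (gaussian_on \<Lambda>) (stratum D \<Lambda> \<inter> N)
      = (\<Sum>L\<in>{L\<in>lineality_tuples C. K L = \<Lambda>}. measure (gaussian_on \<Lambda>) (S L))"
      unfolding stratum using Sm finT disj
      by (intro G.finite_measure_finite_Union) (auto simp: sets_gaussian_on[OF s\<Lambda>])
    also have "\<dots> = (\<Sum>L\<in>{L\<in>{L\<in>T. K L \<in> R}. K L = \<Lambda>}. measure (gaussian_on (K L)) (S L))"
      using \<Lambda> by (intro sum.cong) (auto simp: T_def R_def)
    finally show "measure (gaussian_on \<Lambda>) (stratum D \<Lambda> \<inter> N) = \<dots>" .
  qed
  also have "\<dots> = (\<Sum>L\<in>{L\<in>T. K L \<in> R}. measure (gaussian_on (K L)) (S L))"
    using finT finR by (intro sum.group) auto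
  also have "\<dots> = (\<Sum>L\<in>T. measure (gaussian_on (K L)) (S L))"
  proof (rule sum.mono_neutral_left[OF finT(1)])
    show "\<forall>L\<in>T - {L\<in>T. K L \<in> R}. measure (gaussian_on (K L)) (S L) = 0"
    proof
      fix L assume L: "L \<in> T - {L\<in>T. K L \<in> R}"
      \<comment> \<open>A tuple whose intersection is not the span of any face has no common preimage of strata.\<close>
      have "S L = {}"
      proof (rule ccontr)
        assume "S L \<noteq> {}"
        then obtain x where "x \<in> S L" by blast
        from SK[OF this] have "K L \<in> lineality D ` D" by blast
        then show False using L by (auto simp: T_def R_def)
      qed
      then show "measure (gaussian_on (K L)) (S L) = 0" by simp
    qed
  qed auto
  finally show ?thesis unfolding D_def N_def K_def S_def T_def .
qed

section \<open>Right invariance of random rotations, and reflections\<close>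

lemma measure_ball_eq_of_isometry:
  fixes M :: "'a::euclidean_space measure"
  assumes M: "sets M = sets borel" and f: "f \<in> borel_measurable borel"
    and iso: "\<And>x y. dist (f x) (f y) = dist x y" and inv: "distr M borel f = M"
  shows "measure M (ball (f x) r) = measure M (ball x r)"
proof -
  have fM: "f \<in> borel_measurable M" using f M by (simp cong: measurable_cong_sets)
  have "measure M (ball (f x) r) = measure (distr M borel f) (ball (f x) r)" by (simp add: inv)
  also have "\<dots> = measure M (f -` ball (f x) r \<inter> space M)" by (rule measure_distr[OF fM]) simp
  also have "f -` ball (f x) r \<inter> space M = ball x r"
    using sets_eq_imp_space_eq[OF M] by (auto simp: iso)
  finally show ?thesis .
qed

lemma norm_transpose: "norm (transpose A) = norm A" for A :: "real ^ 'n ^ 'm"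
  unfolding norm_eq_sqrt_inner inner_vec_def transpose_def by (simp, subst sum.swap) simp

lemma norm_matrix_mult_orthogonal:
  fixes Q R :: "real ^ 'n ^ 'n"
  assumes R: "orthogonal_matrix R"
  shows "norm (Q ** R) = norm Q" "norm (R ** Q) = norm Q"
proof -
  have *: "norm (Q ** R) = norm Q" if R: "orthogonal_matrix R" for Q R :: "real ^ 'n ^ 'n"
  proof -
    have "orthogonal_matrix (transpose R)" using R by (simp add: orthogonal_matrix_transpose)
    then have o: "orthogonal_transformation ((*v) (transpose R))"
      unfolding orthogonal_transformation_matrix by simp
    have "(Q ** R) $ i = transpose R *v (Q $ i)" for i
      by (simp add: vec_eq_iff matrix_matrix_mult_def matrix_vector_mult_def transpose_def mult.commute)
    then have "norm ((Q ** R) $ i) = norm (Q $ i)" for i using orthogonal_transformation_norm[OF o] by simp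
    then show ?thesis by (simp add: norm_vec_def)
  qed
  show "norm (Q ** R) = norm Q" by (rule *[OF R])
  have "norm (R ** Q) = norm (transpose Q ** transpose R)"
    by (simp add: norm_transpose flip: matrix_transpose_mul)
  also have "\<dots> = norm Q" using R by (subst *) (simp_all add: norm_transpose orthogonal_matrix_transpose)
  finally show "norm (R ** Q) = norm Q" .
qed

lemma orthogonal_matrix_borel: "{Q :: real^'n^'n. orthogonal_matrix Q} \<in> sets borel"
proof -
  have "{Q \<in> space borel. transpose Q ** Q = (mat 1 :: real^'n^'n)} \<in> sets borel" by measurable
  then show ?thesis by (simp add: orthogonal_matrix)
qed

lemma matrix_diff_distrib:
  fixes A B C :: "real ^ 'n ^ 'n"
  shows "A ** (B - C) = A ** B - A ** C" "(A - B) ** C = A ** C - B ** C"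
  by (simp_all add: vec_eq_iff matrix_matrix_mult_def algebra_simps sum_subtractf)

lemma orthogonal_matrix_inverses:
  "orthogonal_matrix Q \<Longrightarrow> transpose Q ** Q = mat 1" "orthogonal_matrix Q \<Longrightarrow> Q ** transpose Q = mat 1"
  by (simp_all add: orthogonal_matrix_def)

text \<open>The laws of \<open>X\<close> and of \<open>X ** R\<close> are both invariant under left multiplication. Left multiplications are
isometries of the space of matrices, and they act transitively on the orthogonal group, so
\<open>measure_eq_of_uniform_balls\<close> applies to the two laws.\<close>

lemma haar_orthogonal_right_invariant:
  fixes X :: "'w \<Rightarrow> real ^ 'd ^ 'd"
  assumes P: "prob_space P" and X: "X \<in> measurable P orthogonal_borel"
    and haar: "haar_orthogonal (distr P orthogonal_borel X)" and R: "orthogonal_matrix R"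
  shows "distr P orthogonal_borel (\<lambda>\<omega>. X \<omega> ** R) = distr P orthogonal_borel X"
proof -
  interpret P: prob_space P by fact
  have X': "X \<in> borel_measurable P" "\<And>\<omega>. \<omega> \<in> space P \<Longrightarrow> orthogonal_matrix (X \<omega>)"
    using X unfolding orthogonal_borel_def by (auto simp: measurable_restrict_space2_iff)
  note [measurable] = X'(1)
  have into: "Y \<in> measurable P orthogonal_borel"
    if "Y \<in> borel_measurable P" "\<And>\<omega>. \<omega> \<in> space P \<Longrightarrow> orthogonal_matrix (Y \<omega>)" for Y
    using that unfolding orthogonal_borel_def by (auto simp: measurable_restrict_space2_iff)
  have XR: "(\<lambda>\<omega>. X \<omega> ** R) \<in> measurable P orthogonal_borel"
    using X' R by (intro into) (auto simp: orthogonal_matrix_mul)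
  define M where "M = distr P borel X"
  define N where "N = distr P borel (\<lambda>\<omega>. X \<omega> ** R)"
  let ?O = "{Q :: real^'d^'d. orthogonal_matrix Q}"
  have inv: "distr P borel (\<lambda>\<omega>. U ** X \<omega>) = M" if U: "orthogonal_matrix U" for U
  proof -
    let ?D = "distr P orthogonal_borel X"
    have id: "(\<lambda>Q. Q) \<in> borel_measurable (orthogonal_borel :: (real^'d^'d) measure)"
      unfolding orthogonal_borel_def by (rule measurable_restrict_space1) simp
    have mU: "(\<lambda>Q. U ** Q) \<in> measurable orthogonal_borel orthogonal_borel"
      unfolding orthogonal_borel_def measurable_restrict_space2_iff
      using U by (auto simp: space_restrict_space orthogonal_matrix_mul intro!: measurable_restrict_space1)
    have mU': "(\<lambda>Q. U ** Q) \<in> measurable ?D ?D" using mU by (simp cong: measurable_cong_sets)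
    have "distr (distr ?D ?D (\<lambda>Q. U ** Q)) borel (\<lambda>Q. Q) = distr ?D borel (\<lambda>Q. Q)"
      using haar U by (simp add: haar_orthogonal_def)
    moreover have "distr (distr ?D ?D (\<lambda>Q. U ** Q)) borel (\<lambda>Q. Q) = distr P borel (\<lambda>\<omega>. U ** X \<omega>)"
    proof -
      have "distr (distr ?D ?D (\<lambda>Q. U ** Q)) borel (\<lambda>Q. Q) = distr ?D borel (\<lambda>Q. U ** Q)"
        using id mU' by (subst distr_distr) (auto simp: o_def cong: measurable_cong_sets)
      also have "\<dots> = distr P borel (\<lambda>\<omega>. U ** X \<omega>)"
        using X measurable_compose[OF mU id] by (subst distr_distr) (auto simp: o_def)
      finally show ?thesis .
    qed
    moreover have "distr ?D borel (\<lambda>Q. Q) = M"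
      unfolding M_def using X id by (subst distr_distr) (auto simp: o_def)
    ultimately show ?thesis by simp
  qed
  have "M = N"
  proof (rule measure_eq_of_uniform_balls[where S="?O"])
    show "prob_space M" "prob_space N" "sets M = sets borel" "sets N = sets borel"
      by (auto simp: M_def N_def intro!: P.prob_space_distr)
    show "AE x in M. x \<in> ?O" "AE x in N. x \<in> ?O"
      unfolding M_def N_def using X'(2) R orthogonal_matrix_borel[where 'n='d]
      by (simp_all add: AE_distr_iff orthogonal_matrix_mul)
    have iso: "dist (U ** A) (U ** B) = dist A B" if "orthogonal_matrix U" for U A B :: "real^'d^'d"
      using norm_matrix_mult_orthogonal(2)[OF that, of "A - B"] by (simp add: dist_norm matrix_diff_distrib)
    have meas: "(\<lambda>A :: real^'d^'d. U ** A) \<in> borel_measurable borel" for U :: "real^'d^'d" by measurable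
    have MU: "distr M borel (\<lambda>A. U ** A) = M" if "orthogonal_matrix U" for U
      using inv[OF that] meas[of U] by (simp add: M_def distr_distr o_def)
    have NM: "N = distr M borel (\<lambda>A. A ** R)" by (simp add: M_def N_def distr_distr o_def)
    have NU: "distr N borel (\<lambda>A. U ** A) = N" if "orthogonal_matrix U" for U
    proof -
      have sM: "sets M = sets borel" by (simp add: M_def)
      have r: "(\<lambda>A :: real^'d^'d. A ** R) \<in> borel_measurable M"
        "(\<lambda>A :: real^'d^'d. U ** A) \<in> borel_measurable M"
        using meas[of U] sM by (auto cong: measurable_cong_sets)
      have "distr N borel (\<lambda>A. U ** A) = distr (distr M borel (\<lambda>A. U ** A)) borel (\<lambda>A. A ** R)"
        unfolding NM using meas[of U] r by (simp add: distr_distr o_def matrix_mul_assoc)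
      then show ?thesis by (simp add: MU[OF that] NM)
    qed
    fix x y :: "real^'d^'d" and r :: real assume "x \<in> ?O" "y \<in> ?O"
    then have U: "orthogonal_matrix (y ** transpose x)" and y: "y = (y ** transpose x) ** x"
      by (auto simp: orthogonal_matrix_mul orthogonal_matrix_transpose orthogonal_matrix_inverses simp flip: matrix_mul_assoc)
    show "measure M (ball x r) = measure M (ball y r)" "measure N (ball x r) = measure N (ball y r)"
      using measure_ball_eq_of_isometry[OF _ meas iso[OF U] MU[OF U], of x r]
        measure_ball_eq_of_isometry[OF _ meas iso[OF U] NU[OF U], of x r] y by (simp_all add: M_def N_def)
  qed
  show ?thesis
  proof (rule measure_eqI)
    fix A assume "A \<in> sets (distr P orthogonal_borel (\<lambda>\<omega>. X \<omega> ** R))"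
    then have A: "A \<in> sets orthogonal_borel" by simp
    then have Ab: "A \<in> sets borel"
      unfolding orthogonal_borel_def using orthogonal_matrix_borel[where 'n='d]
      by (subst (asm) sets_restrict_space_iff) auto
    have "emeasure (distr P orthogonal_borel (\<lambda>\<omega>. X \<omega> ** R)) A = emeasure N A"
      using A Ab XR by (simp add: emeasure_distr N_def)
    also have "\<dots> = emeasure (distr P orthogonal_borel X) A"
      using A Ab X by (simp add: emeasure_distr M_def flip: \<open>M = N\<close>)
    finally show "emeasure (distr P orthogonal_borel (\<lambda>\<omega>. X \<omega> ** R)) A = emeasure (distr P orthogonal_borel X) A" .
  qed simp
qed

text \<open>Right multiplication by fixed matrices preserves independence and the marginal laws, and these
determine the joint law.\<close>

lemma joint_haar_right_invariant:
  fixes Q :: "'i::finite \<Rightarrow> 'w \<Rightarrow> real ^ 'd ^ 'd"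
  assumes P: "prob_space P" and ind: "prob_space.indep_vars P (\<lambda>_. orthogonal_borel) Q UNIV"
    and haar: "\<And>i. haar_orthogonal (distr P orthogonal_borel (Q i))"
    and R: "\<And>i. orthogonal_matrix (R i)"
  shows "distr P borel (\<lambda>\<omega>. \<chi> i. Q i \<omega> ** R i) = distr P borel (\<lambda>\<omega>. \<chi> i. Q i \<omega>)"
proof -
  interpret P: prob_space P by fact
  let ?ob = "orthogonal_borel :: (real^'d^'d) measure"
  have Q: "Q i \<in> measurable P ?ob" for i using ind by (auto simp: P.indep_vars_def)
  have mR: "(\<lambda>A. A ** R i) \<in> measurable ?ob ?ob" for i
    unfolding orthogonal_borel_def measurable_restrict_space2_iff
    using R by (auto simp: space_restrict_space orthogonal_matrix_mul intro!: measurable_restrict_space1)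
  have QR: "(\<lambda>\<omega>. Q i \<omega> ** R i) \<in> measurable P ?ob" for i using measurable_compose[OF Q mR] .
  have indR: "P.indep_vars (\<lambda>_. ?ob) (\<lambda>i \<omega>. Q i \<omega> ** R i) UNIV"
    using P.indep_vars_compose2[OF ind mR] .
  have id: "(\<lambda>Q. Q) \<in> borel_measurable ?ob"
    unfolding orthogonal_borel_def by (rule measurable_restrict_space1) simp
  have vec: "(\<lambda>g. \<chi> i. g i) \<in> borel_measurable (PiM (UNIV::'i set) (\<lambda>_. ?ob))"
  proof (rule borel_measurable_vecI)
    fix i
    have "(\<lambda>g. g i) \<in> measurable (PiM (UNIV::'i set) (\<lambda>_. ?ob)) ?ob" by (rule measurable_component_singleton) simp
    from measurable_compose[OF this id]
    show "(\<lambda>g. (\<chi> i. g i) $ i) \<in> borel_measurable (PiM (UNIV::'i set) (\<lambda>_. ?ob))" by simp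
  qed
  have joint: "distr P borel (\<lambda>\<omega>. \<chi> i. X i \<omega>) = distr (PiM UNIV (\<lambda>i. distr P ?ob (X i))) borel (\<lambda>g. \<chi> i. g i)"
    if X: "\<And>i. X i \<in> measurable P ?ob" and ind: "P.indep_vars (\<lambda>_. ?ob) X UNIV"
    for X :: "'i \<Rightarrow> 'w \<Rightarrow> real ^ 'd ^ 'd"
  proof -
    have "distr P (PiM UNIV (\<lambda>_. ?ob)) (\<lambda>\<omega>. \<lambda>i\<in>UNIV. X i \<omega>) = PiM UNIV (\<lambda>i. distr P ?ob (X i))"
      using P.indep_vars_iff_distr_eq_PiM[where I=UNIV and M'="\<lambda>_. ?ob" and X=X] X ind by simp
    then have "distr (PiM UNIV (\<lambda>i. distr P ?ob (X i))) borel (\<lambda>g. \<chi> i. g i)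
      = distr (distr P (PiM UNIV (\<lambda>_. ?ob)) (\<lambda>\<omega>. \<lambda>i\<in>UNIV. X i \<omega>)) borel (\<lambda>g. \<chi> i. g i)" by simp
    also have "\<dots> = distr P borel (\<lambda>\<omega>. \<chi> i. X i \<omega>)"
    proof -
      have "(\<lambda>\<omega>. \<lambda>i\<in>UNIV. X i \<omega>) \<in> measurable P (PiM UNIV (\<lambda>_. ?ob))"
        using X by (intro measurable_restrict)
      from distr_distr[OF vec this] show ?thesis by (simp add: o_def restrict_def)
    qed
    finally show ?thesis ..
  qed
  show ?thesis
    unfolding joint[OF Q ind] joint[OF QR indR]
    using haar_orthogonal_right_invariant[OF P Q haar R] by simp
qed

text \<open>The reflection in the hyperplane orthogonal to \<open>u\<close>. Since \<open>u \<bullet> x / 0 = 0\<close>, it is the identity for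
\<open>u = 0\<close>.\<close>

definition householder :: "'a::euclidean_space \<Rightarrow> 'a \<Rightarrow> 'a" where
  "householder u x = x - (2 * (u \<bullet> x) / (u \<bullet> u)) *\<^sub>R u"

lemma linear_householder: "linear (householder u)"
  by (rule linearI) (simp_all add: householder_def inner_simps algebra_simps add_divide_distrib)

lemma householder_householder [simp]: "householder u (householder u x) = x"
  by (cases "u = 0") (simp_all add: householder_def inner_simps algebra_simps)

lemma orthogonal_transformation_householder: "orthogonal_transformation (householder u)"
  unfolding orthogonal_transformation_def
proof (intro conjI allI)
  show "householder u v \<bullet> householder u w = v \<bullet> w" for v w
    by (cases "u = 0") (simp_all add: householder_def inner_simps algebra_simps inner_commute)
qed (rule linear_householder)

lemma householder_mem: "subspace L \<Longrightarrow> u \<in> L \<Longrightarrow> householder u x \<in> L \<longleftrightarrow> x \<in> L"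
  unfolding householder_def
  by (metis add.commute diff_add_cancel subspace_add subspace_diff subspace_mul)

lemma householder_swap:
  assumes "norm x = norm y"
  shows "householder (x - y) x = y"
proof (cases "x = y")
  case False
  have xy: "x \<bullet> x = y \<bullet> y" using assms by (simp add: norm_eq)
  then have "(x - y) \<bullet> (x - y) = 2 * ((x - y) \<bullet> x)" by (simp add: inner_simps inner_commute)
  moreover have "(x - y) \<bullet> (x - y) \<noteq> 0" using False by simp
  ultimately show ?thesis by (simp add: householder_def)
qed (simp add: householder_def)

lemma inner_householder: "householder u x \<bullet> y = x \<bullet> householder u y"
  by (simp add: householder_def inner_simps inner_commute)

lemma sgn_householder: "sgn (householder u x) = householder u (sgn x)"
  by (simp add: sgn_div_norm linear_scale[OF linear_householder]
      orthogonal_transformation_norm[OF orthogonal_transformation_householder])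

lemma matrix_householder_mult: "matrix (householder u) *v x = householder u x" for u :: "real^'n"
  by (rule fun_cong[OF matrix_vector_mul(2)[OF linear_householder]])

lemma orthogonal_matrix_householder: "orthogonal_matrix (matrix (householder u))" for u :: "real^'n"
  using orthogonal_transformation_householder[of u] unfolding orthogonal_transformation_matrix by blast

lemma transpose_matrix_householder_mult: "transpose (matrix (householder u)) *v x = householder u x" for u :: "real^'n"
proof -
  have "transpose (matrix (householder u)) *v x
     = transpose (matrix (householder u)) *v (matrix (householder u) *v (householder u x))"
    by (simp add: matrix_householder_mult)
  also have "\<dots> = householder u x"
    unfolding matrix_vector_mul_assoc orthogonal_matrix_inverses(1)[OF orthogonal_matrix_householder] by simp
  finally show ?thesis .
qed

section \<open>General position of randomly rotated subspaces\<close>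

lemma dim_Int_hyperplane:
  fixes K :: "'a::euclidean_space set"
  assumes K: "subspace K" and x: "x \<in> K" "a \<bullet> x \<noteq> 0"
  shows "dim {y \<in> K. a \<bullet> y = 0} + 1 = dim K"
proof -
  define p where "p = oproj K a"
  have p: "p \<in> K" "\<And>y. y \<in> K \<Longrightarrow> p \<bullet> y = a \<bullet> y"
    using oproj_mem[OF K] inner_oproj[OF K, of _ a] by (auto simp: p_def inner_commute)
  then have "p \<noteq> 0" using x by force
  have "dim {y \<in> K. \<forall>x\<in>span {p}. orthogonal x y} + dim (span {p}) = dim K"
    using p(1) K span_minimal[of "{p}" K] by (intro dim_subspace_orthogonal_to_vectors) auto
  moreover have "{y \<in> K. \<forall>x\<in>span {p}. orthogonal x y} = {y \<in> K. a \<bullet> y = 0}"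
  proof -
    have "(\<forall>x\<in>span {p}. orthogonal x y) \<longleftrightarrow> a \<bullet> y = 0" if "y \<in> K" for y
    proof
      assume "\<forall>x\<in>span {p}. orthogonal x y"
      then have "orthogonal p y" by (simp add: span_base)
      then show "a \<bullet> y = 0" using p that by (simp add: orthogonal_def)
    next
      assume "a \<bullet> y = 0"
      then have "p \<bullet> y = 0" using p that by simp
      then show "\<forall>x\<in>span {p}. orthogonal x y" by (auto simp: span_singleton orthogonal_def)
    qed
    then show ?thesis by blast
  qed
  ultimately show ?thesis using \<open>p \<noteq> 0\<close> by (simp add: dim_span)
qed

text \<open>\<open>\<nu>\<close> plays the role of the joint law of the rotations \<open>Q i\<close>, and \<open>S i\<close> that of the inverse of \<open>T i\<close>.
Working with a measure on tuples of matrices lets all randomness be expressed by Borel functions of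
one variable.\<close>

locale rotation_invariant_frames = prob_space \<nu>
  for \<nu> :: "(real ^ 'd ^ 'd ^ 'i::finite) measure" +
  fixes S :: "'i \<Rightarrow> real ^ 'd ^ 'd"
  assumes sets_nu [measurable_cong, simp]: "sets \<nu> = sets borel"
    and orthogonal_frames: "AE V in \<nu>. \<forall>i. orthogonal_matrix (V $ i)"
    and right_invariant: "\<And>R. (\<And>i. orthogonal_matrix (R i)) \<Longrightarrow> distr \<nu> borel (\<lambda>V. \<chi> i. V $ i ** R i) = \<nu>"
    and invertible_S: "\<And>i. invertible (S i)"
begin

lemma space_nu [simp]: "space \<nu> = UNIV"
  using sets_eq_imp_space_eq[OF sets_nu] by simp

text \<open>If \<open>V $ i\<close> is orthogonal and \<open>S i\<close> is the inverse of \<open>T i\<close>, then this is the inverse of \<open>T i ** V $ i\<close>.\<close>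

definition pull :: "'i \<Rightarrow> real ^ 'd ^ 'd ^ 'i \<Rightarrow> real ^ 'd ^ 'd" where
  "pull i V = transpose (V $ i) ** S i"

text \<open>For \<open>V\<close> built from the rotations \<open>Q i\<close>, the intersection of the subspaces \<open>T i (Q i (L i))\<close>.\<close>

definition meet :: "('i \<Rightarrow> (real ^ 'd) set) \<Rightarrow> real ^ 'd ^ 'd ^ 'i \<Rightarrow> (real ^ 'd) set" where
  "meet L V = {x. \<forall>i. pull i V *v x \<in> L i}"

definition turn :: "('i \<Rightarrow> real ^ 'd) \<Rightarrow> real ^ 'd ^ 'd ^ 'i \<Rightarrow> real ^ 'd ^ 'd ^ 'i" where
  "turn u V = (\<chi> i. V $ i ** matrix (householder (u i)))"

lemma measurable_pull [measurable (raw)]: "f \<in> borel_measurable M \<Longrightarrow> (\<lambda>w. pull i (f w)) \<in> borel_measurable M"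
  unfolding pull_def
  by (intro borel_measurable_matrix_matrix_mult borel_measurable_transpose borel_measurable_vec_nth borel_measurable_const)

lemma measurable_turn [measurable (raw)]: "f \<in> borel_measurable M \<Longrightarrow> (\<lambda>w. turn u (f w)) \<in> borel_measurable M"
  unfolding turn_def by (intro borel_measurable_vecI) simp

lemma distr_turn: "distr \<nu> borel (turn u) = \<nu>"
  unfolding turn_def by (intro right_invariant orthogonal_matrix_householder)

lemma pull_turn: "pull i (turn u V) *v x = householder (u i) (pull i V *v x)"
  by (simp add: pull_def turn_def matrix_transpose_mul transpose_matrix_householder_mult
      del: transpose_matrix_vector flip: matrix_vector_mul_assoc)

lemma subspace_meet: "(\<And>i. subspace (L i)) \<Longrightarrow> subspace (meet L V)"
  unfolding meet_def by (intro subspace_linear_family_vimage linear_matrix_vector_mult)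

lemma meet_turn:
  assumes "\<And>i. subspace (L i)" "\<And>i. u i \<in> L i"
  shows "meet L (turn u V) = meet L V"
  by (simp add: meet_def pull_turn householder_mem[OF assms])

lemma AE_pull_inj: "AE V in \<nu>. \<forall>i x. x \<noteq> 0 \<longrightarrow> pull i V *v x \<noteq> 0"
  using orthogonal_frames
proof eventually_elim
  case (elim V)
  show ?case
  proof (intro allI impI notI)
    fix i x assume x: "x \<noteq> 0" and 0: "pull i V *v x = 0"
    obtain T where T: "T ** S i = mat 1" using invertible_S[of i] unfolding invertible_def by blast
    have "x = (T ** (V $ i)) *v (pull i V *v x)"
      using orthogonal_matrix_inverses(2)[of "V $ i"] elim T
      by (simp add: pull_def matrix_vector_mul_assoc matrix_mul_assoc)
         (metis matrix_mul_assoc matrix_mul_rid matrix_vector_mul_lid)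
    then show False using x 0 by simp
  qed
qed

lemma measurable_oproj_meet [measurable (raw)]:
  assumes "\<And>i. subspace (L i)" and [measurable]: "f \<in> borel_measurable M" "g \<in> borel_measurable M"
  shows "(\<lambda>w. oproj (meet L (f w)) (g w)) \<in> borel_measurable M"
  unfolding meet_def by (rule measurable_oproj_vimage[OF _ _ assms(1)]) measurable

lemma measurable_dim_meet [measurable (raw)]:
  assumes "\<And>i. subspace (L i)" and [measurable]: "f \<in> borel_measurable M"
  shows "(\<lambda>w. real (dim (meet L (f w)))) \<in> borel_measurable M"
  unfolding meet_def by (rule measurable_dim_vimage[OF _ assms(1)]) measurable

text \<open>Turning the \<open>j\<close>-th frame by a reflection that preserves \<open>L j\<close> leaves the intersection unchanged and
moves \<open>u\<close> to any prescribed vector of \<open>L j\<close> of the same length. So the claim for \<open>u\<close> follows from the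
claim for a single nonzero vector \<open>w\<close> of \<open>L j\<close>. For fixed \<open>V\<close>, the bad vectors \<open>w\<close> lie in a proper
hyperplane of \<open>L j\<close>, a Gaussian null set; exchanging the order of the two almost everywhere
quantifiers yields a vector \<open>w\<close> that is good for almost every \<open>V\<close>.\<close>

lemma AE_meet_not_orthogonal:
  assumes L: "\<And>i. subspace (L i)" and u: "u \<in> L j" "u \<noteq> 0"
  shows "AE V in \<nu>. meet L V = {0} \<or> (\<exists>x\<in>meet L V. u \<bullet> (pull j V *v x) \<noteq> 0)"
proof -
  define good where "good w V \<longleftrightarrow> meet L V = {0} \<or> (\<exists>x\<in>meet L V. w \<bullet> (pull j V *v x) \<noteq> 0)" for w V
  \<comment> \<open>Rewritten with projections, the condition is visibly measurable in both variables.\<close>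
  have good_iff: "good w V \<longleftrightarrow> real (dim (meet L V)) = 0 \<or> oproj (meet L V) (transpose (pull j V) *v w) \<noteq> 0" for w V
  proof -
    let ?K = "meet L V"
    have K: "subspace ?K" by (rule subspace_meet[OF L])
    have "?K = {0} \<longleftrightarrow> dim ?K = 0"
      using subspace_0[OF K] by auto
    moreover have "w \<bullet> (pull j V *v x) = (transpose (pull j V) *v w) \<bullet> x" for x
      by (metis dot_lmul_matrix vector_transpose_matrix transpose_matrix_vector)
    moreover have "(\<exists>x\<in>?K. a \<bullet> x \<noteq> 0) \<longleftrightarrow> oproj ?K a \<noteq> 0" for a
      using inner_oproj[OF K, of _ a] oproj_mem[OF K, of a]
      by (metis inner_commute inner_eq_zero_iff inner_zero_right)
    ultimately show ?thesis by (simp add: good_def)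
  qed
  have good_meas: "Measurable.pred (M1 \<Otimes>\<^sub>M M2) (\<lambda>p. good (snd p) (fst p))"
    if [measurable_cong]: "sets M1 = sets borel" "sets M2 = sets borel" for M1 M2
  proof -
    note [measurable] = measurable_oproj_meet[of L, OF L] measurable_dim_meet[of L, OF L]
    show ?thesis unfolding good_iff by measurable
  qed
  let ?G = "gaussian_on (L j)"
  interpret G: prob_space ?G by (rule prob_space_gaussian_on[OF L])
  have sG[measurable_cong]: "sets ?G = sets borel" by (rule sets_gaussian_on[OF L])
  interpret PG: pair_sigma_finite \<nu> ?G ..
  have "AE V in \<nu>. AE w in ?G. good w V"
    using AE_pull_inj
  proof eventually_elim
    case (elim V)
    show ?case
    proof (cases "meet L V = {0}")
      case False
      then obtain x where x: "x \<in> meet L V" "x \<noteq> 0" using subspace_0[OF subspace_meet[of L, OF L]] by blast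
      have "pull j V *v x \<in> L j" "pull j V *v x \<noteq> 0" using x elim by (auto simp: meet_def)
      from AE_gaussian_on_hyperplane[OF L this] show ?thesis
        by eventually_elim (use x in \<open>auto simp: good_def inner_commute\<close>)
    qed (simp add: good_def)
  qed
  then have "AE w in ?G. AE V in \<nu>. good w V"
    by (subst (asm) PG.AE_commute) (use good_meas[OF sets_nu sG] in \<open>simp_all only: pred_def\<close>)
  with AE_gaussian_on_mem[OF L, of j] AE_gaussian_on_hyperplane[OF L u]
  have "AE w in ?G. (AE V in \<nu>. good w V) \<and> w \<in> L j \<and> w \<noteq> 0"
    by eventually_elim auto
  then obtain w where w: "AE V in \<nu>. good w V" "w \<in> L j" "w \<noteq> 0"
    using eventually_happens'[OF G.ae_filter_bot] by blast
  \<comment> \<open>Only the direction of w matters; rescaling gives w the length of u, so that a reflection can exchange them.\<close>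
  define c where "c = norm u / norm w"
  have c: "c \<noteq> 0" and cw: "norm (c *\<^sub>R w) = norm u" using u w by (auto simp: c_def)
  define z where "z i = (if i = j then c *\<^sub>R w - u else 0)" for i
  have zL: "z i \<in> L i" for i
    using L u w by (simp add: z_def subspace_diff subspace_mul subspace_0)
  have "AE V in distr \<nu> borel (turn z). good w V" using w(1) unfolding distr_turn .
  then have "AE V in \<nu>. good w (turn z V)"
  proof (subst (asm) AE_distr_iff)
    have "Measurable.pred (borel \<Otimes>\<^sub>M borel) (\<lambda>p. good (snd p) (fst p))" by (rule good_meas) simp_all
    then have "Measurable.pred borel (\<lambda>V. good (snd (V, w)) (fst (V, w)))"
      by (rule measurable_compose[rotated]) simp
    then show "{V \<in> space borel. good w V} \<in> sets borel" by simp
  qed auto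
  then show ?thesis
  proof eventually_elim
    case (elim V)
    have "w \<bullet> (pull j (turn z V) *v x) = (1 / c) * (u \<bullet> (pull j V *v x))" for x
    proof -
      have "c * (w \<bullet> (pull j (turn z V) *v x)) = householder (c *\<^sub>R w - u) (c *\<^sub>R w) \<bullet> (pull j V *v x)"
        by (simp add: pull_turn z_def inner_householder del: householder_householder)
      then show ?thesis using c by (simp add: householder_swap[OF cw] field_simps)
    qed
    then show ?case using elim c by (simp add: good_def meet_turn[OF L zL])
  qed
qed

text \<open>If every \<open>L i\<close> is the whole space, then so is the intersection. Any other tuple arises from this one
by repeatedly cutting some \<open>L j\<close> with the hyperplane orthogonal to a vector \<open>u\<close> of \<open>L j\<close>. By
\<open>AE_meet_not_orthogonal\<close>, such a cut almost surely reduces the dimension of the intersection by exactly one,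
unless the intersection is already \<open>{0}\<close>. The truncated subtraction accounts for the latter case.\<close>

lemma AE_dim_meet:
  assumes "\<And>i. subspace (L i)"
  shows "AE V in \<nu>. dim (meet L V) = (\<Sum>i\<in>UNIV. dim (L i)) - (CARD('i) - 1) * CARD('d)"
  using assms
proof (induction "\<Sum>i\<in>UNIV. CARD('d) - dim (L i)" arbitrary: L rule: less_induct)
  case less
  note L = less.prems
  show ?case
  proof (cases "\<forall>i. L i = UNIV")
    case True
    have "0 < CARD('i)" by simp
    then have "CARD('i) * CARD('d) - (CARD('i) - 1) * CARD('d) = CARD('d)"
      by (metis Suc_diff_1 add_diff_cancel_right' mult_Suc)
    then show ?thesis using True by (simp add: meet_def)
  next
    case False
    then obtain j where j: "L j \<noteq> UNIV" by blast
    have "dim (L j) < DIM(real^'d)"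
      using j L[of j] dim_eq_full[of "L j"] dim_subset_UNIV[of "L j"] by (metis le_neq_implies_less span_eq_iff)
    then obtain u where u: "u \<noteq> 0" "\<And>y. y \<in> L j \<Longrightarrow> u \<bullet> y = 0"
      using orthogonal_to_subspace_exists[of "L j"] L[of j] by (metis orthogonal_def span_eq_iff)
    define L' where "L' = L(j := span (insert u (L j)))"
    have L': "subspace (L' i)" for i using L by (simp add: L'_def)
    have uL': "u \<in> L' j" by (simp add: L'_def span_base)
    have "u \<notin> L j" using u by force
    then have dim': "dim (L' j) = dim (L j) + 1"
      using L[of j] by (simp add: L'_def dim_insert span_eq_iff[THEN iffD2])
    have Lj: "L j = {y \<in> L' j. u \<bullet> y = 0}"
    proof (intro set_eqI iffI)
      fix y assume "y \<in> {y \<in> L' j. u \<bullet> y = 0}"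
      then have y: "y \<in> span (insert u (L j))" "u \<bullet> y = 0" by (auto simp: L'_def)
      then obtain c where "y - c *\<^sub>R u \<in> span (L j)" using span_breakdown_eq by blast
      then have yc: "y - c *\<^sub>R u \<in> L j" using L[of j] by (simp add: span_eq_iff[THEN iffD2])
      have "c * (u \<bullet> u) = 0" using u(2)[OF yc] y(2) by (simp add: inner_simps)
      then show "y \<in> L j" using u(1) yc by simp
    qed (use u in \<open>auto simp: L'_def span_base\<close>)
    have L'_other: "L' i = L i" if "i \<noteq> j" for i using that by (simp add: L'_def)
    have sum': "(\<Sum>i\<in>UNIV. dim (L' i)) = (\<Sum>i\<in>UNIV. dim (L i)) + 1"
    proof -
      have "(\<Sum>i\<in>UNIV. dim (L' i)) = dim (L' j) + (\<Sum>i\<in>UNIV - {j}. dim (L' i))" by (rule sum.remove) auto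
      also have "(\<Sum>i\<in>UNIV - {j}. dim (L' i)) = (\<Sum>i\<in>UNIV - {j}. dim (L i))"
        by (intro sum.cong refl) (simp add: L'_other)
      also have "dim (L' j) + (\<Sum>i\<in>UNIV - {j}. dim (L i)) = 1 + (dim (L j) + (\<Sum>i\<in>UNIV - {j}. dim (L i)))"
        by (simp add: dim')
      also have "dim (L j) + (\<Sum>i\<in>UNIV - {j}. dim (L i)) = (\<Sum>i\<in>UNIV. dim (L i))" by (rule sum.remove[symmetric]) auto
      finally show ?thesis by simp
    qed
    have less': "(\<Sum>i\<in>UNIV. CARD('d) - dim (L' i)) < (\<Sum>i\<in>UNIV. CARD('d) - dim (L i))"
    proof (rule sum_strict_mono_ex1)
      show "\<forall>i\<in>UNIV. CARD('d) - dim (L' i) \<le> CARD('d) - dim (L i)"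
        using dim' L'_other by (metis diff_le_mono2 le_add1 order_refl)
      show "\<exists>i\<in>UNIV. CARD('d) - dim (L' i) < CARD('d) - dim (L i)"
        using dim' \<open>dim (L j) < DIM(real^'d)\<close> by (intro bexI[of _ j]) auto
    qed simp
    show ?thesis
      using less.hyps[OF less' L'] AE_meet_not_orthogonal[of L', OF L' uL' u(1)]
    proof eventually_elim
      case (elim V)
      have K: "meet L V = {x \<in> meet L' V. u \<bullet> (pull j V *v x) = 0}"
      proof -
        have split: "(\<forall>i. Q i) \<longleftrightarrow> Q j \<and> (\<forall>i. i \<noteq> j \<longrightarrow> Q i)" for Q by metis
        have "pull j V *v x \<in> L j \<longleftrightarrow> pull j V *v x \<in> L' j \<and> u \<bullet> (pull j V *v x) = 0" for x
          unfolding Lj by blast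
        then show ?thesis
          unfolding meet_def split[of "\<lambda>i. pull i V *v _ \<in> L i"] split[of "\<lambda>i. pull i V *v _ \<in> L' i"]
          using L'_other by auto
      qed
      show ?case
      proof (cases "meet L' V = {0}")
        case True
        then have "meet L V = {0}" using K by (auto simp: subspace_0[OF subspace_meet[of L, OF L]])
        then show ?thesis using elim(1) sum' True by simp
      next
        case False
        then obtain x where x: "x \<in> meet L' V" "u \<bullet> (pull j V *v x) \<noteq> 0" using elim(2) by blast
        have tr: "u \<bullet> (pull j V *v y) = (transpose (pull j V) *v u) \<bullet> y" for y
          by (metis dot_lmul_matrix vector_transpose_matrix transpose_matrix_vector)
        have "dim (meet L V) + 1 = dim (meet L' V)"
          unfolding K tr by (rule dim_Int_hyperplane[OF subspace_meet[OF L'] x[unfolded tr]])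
        then show ?thesis using elim(1) sum' by simp
      qed
    qed
  qed
qed

end

section \<open>Averaging the Gaussian measure of an intersection\<close>

definition directions :: "'a::real_normed_vector ^ 'i::finite \<Rightarrow> 'a ^ 'i" where
  "directions x = (\<chi> i. sgn (x $ i))"

definition reflect :: "('i::finite \<Rightarrow> 'a::euclidean_space) \<Rightarrow> 'a ^ 'i \<Rightarrow> 'a ^ 'i" where
  "reflect u x = (\<chi> i. householder (u i) (x $ i))"

lemma orthogonal_transformation_reflect: "orthogonal_transformation (reflect u)"
  unfolding orthogonal_transformation
proof (intro conjI allI)
  show "linear (reflect u)"
    by (rule linearI)
       (simp_all add: reflect_def vec_eq_iff linear_add[OF linear_householder] linear_scale[OF linear_householder])
  show "norm (reflect u v) = norm v" for v
    by (simp add: norm_vec_def reflect_def orthogonal_transformation_norm[OF orthogonal_transformation_householder])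
qed

lemma directions_reflect: "directions (reflect u x) = reflect u (directions x)"
  by (simp add: directions_def reflect_def sgn_householder)

lemma measurable_directions [measurable]:
  "directions \<in> borel_measurable (borel :: ('a::euclidean_space ^ 'i::finite) measure)"
proof (rule borel_measurable_vecI)
  fix i
  have [measurable]: "(sgn :: 'a \<Rightarrow> 'a) \<in> borel_measurable borel"
    unfolding sgn_div_norm[abs_def] by measurable
  show "(\<lambda>x::'a^'i. directions x $ i) \<in> borel_measurable borel" unfolding directions_def by simp
qed

lemma measurable_reflect [measurable]: "reflect u \<in> borel_measurable borel"
  by (intro borel_measurable_linear orthogonal_transformation_linear orthogonal_transformation_reflect)

definition sphere_product :: "('i::finite \<Rightarrow> 'a::euclidean_space set) \<Rightarrow> ('a ^ 'i) set" where
  "sphere_product L = {z. \<forall>i. z $ i \<in> L i \<and> norm (z $ i) = 1}"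

text \<open>A reflection of \<open>L i\<close> exchanges two given unit vectors of \<open>L i\<close>. Hence any two points of a product of
unit spheres are exchanged by a tuple of reflections, and balls around them have the same mass.\<close>

lemma measure_eq_of_reflection_invariant:
  fixes M N :: "('a::euclidean_space ^ 'i::finite) measure"
  assumes L: "\<And>i. subspace (L i)"
    and M: "prob_space M" "sets M = sets borel" "AE z in M. z \<in> sphere_product L"
      "\<And>u. (\<And>i. u i \<in> L i) \<Longrightarrow> distr M borel (reflect u) = M"
    and N: "prob_space N" "sets N = sets borel" "AE z in N. z \<in> sphere_product L"
      "\<And>u. (\<And>i. u i \<in> L i) \<Longrightarrow> distr N borel (reflect u) = N"
  shows "M = N"
proof (rule measure_eq_of_uniform_balls[OF M(1-3) N(1-3)])
  fix x y :: "'a^'i" and r :: real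
  assume x: "x \<in> sphere_product L" and y: "y \<in> sphere_product L"
  define u where "u i = x $ i - y $ i" for i
  have u: "u i \<in> L i" for i using x y L by (simp add: u_def sphere_product_def subspace_diff)
  have "reflect u x = y"
    using x y by (simp add: reflect_def u_def vec_eq_iff householder_swap sphere_product_def)
  moreover have "dist (reflect u v) (reflect u w) = dist v w" for v w
    using orthogonal_transformation_norm[OF orthogonal_transformation_reflect, of u "v - w"]
    by (simp add: dist_norm linear_diff[OF orthogonal_transformation_linear[OF orthogonal_transformation_reflect]])
  ultimately show "measure M (ball x r) = measure M (ball y r)" "measure N (ball x r) = measure N (ball y r)"
    using measure_ball_eq_of_isometry[OF M(2) measurable_reflect _ M(4)[OF u], of x r]
      measure_ball_eq_of_isometry[OF N(2) measurable_reflect _ N(4)[OF u], of x r] by simp_all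
qed

lemma directions_mem_set_product:
  assumes A: "\<And>i c x. 0 < c \<Longrightarrow> x \<in> A i \<Longrightarrow> c *\<^sub>R x \<in> A i"
  shows "directions x \<in> set_product A \<longleftrightarrow> x \<in> set_product A"
proof -
  have "sgn v \<in> A i \<longleftrightarrow> v \<in> A i" for v i
  proof (cases "v = 0")
    case False
    then show ?thesis
      using A[of "1 / norm v" v i] A[of "norm v" "sgn v" i] by (auto simp: sgn_div_norm divide_inverse)
  qed simp
  then show ?thesis by (simp add: mem_set_product directions_def)
qed

lemma set_product_borel:
  fixes A :: "'i::finite \<Rightarrow> 'a::euclidean_space set"
  assumes [measurable]: "\<And>i. A i \<in> sets borel"
  shows "set_product A \<in> sets borel"
proof -
  have "{x\<in>space borel. \<forall>i. (x::'a^'i) $ i \<in> A i} \<in> sets borel" by measurable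
  then show ?thesis by (simp add: set_product_def)
qed

lemma directions_gaussian:
  fixes L :: "'i::finite \<Rightarrow> 'a::euclidean_space set"
  assumes L: "\<And>i. subspace (L i)" and nz: "\<And>i. L i \<noteq> {0}"
  defines "M \<equiv> distr (gaussian_on (set_product L)) borel directions"
  shows "prob_space M" "sets M = sets borel" "AE z in M. z \<in> sphere_product L"
    "(\<And>i. u i \<in> L i) \<Longrightarrow> distr M borel (reflect u) = M"
proof -
  let ?G = "gaussian_on (set_product L)"
  have sP: "subspace (set_product L)" by (rule subspace_set_product[OF L])
  interpret G: prob_space ?G by (rule prob_space_gaussian_on[OF sP])
  have sG [measurable_cong]: "sets ?G = sets borel" by (rule sets_gaussian_on[OF sP])
  show "prob_space M" "sets M = sets borel" unfolding M_def by (auto intro!: G.prob_space_distr)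
  have "AE x in ?G. x $ i \<noteq> 0" for i
  proof -
    obtain a where a: "a \<in> L i" "a \<noteq> 0" using nz[of i] subspace_0[OF L] by blast
    have "axis i a \<in> set_product L" using a subspace_0[OF L] by (auto simp: mem_set_product axis_def)
    moreover have "axis i a \<noteq> 0" using a by (simp add: axis_eq_0_iff)
    ultimately show ?thesis
      using AE_gaussian_on_hyperplane[OF sP, of "axis i a"] by (auto simp: inner_axis' elim: eventually_mono)
  qed
  then have nz': "AE x in ?G. \<forall>i. x $ i \<noteq> 0" by (simp add: AE_all_countable)
  have [measurable]: "sphere_product L \<in> sets borel"
  proof -
    have [measurable]: "L i \<in> sets borel" for i using closed_subspace[OF L] by simp
    have "{z\<in>space borel. \<forall>i. (z::'a^'i) $ i \<in> L i \<and> norm (z $ i) = 1} \<in> sets borel" by measurable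
    then show ?thesis by (simp add: sphere_product_def)
  qed
  have "AE x in ?G. directions x \<in> sphere_product L"
    using nz' AE_gaussian_on_mem[OF sP]
    by eventually_elim
       (simp add: sphere_product_def directions_def mem_set_product norm_sgn, simp add: sgn_div_norm subspace_mul[OF L])
  then show "AE z in M. z \<in> sphere_product L"
    unfolding M_def by (subst AE_distr_iff) auto
  assume u: "\<And>i. u i \<in> L i"
  have "distr M borel (reflect u) = distr (distr ?G borel (reflect u)) borel directions"
    unfolding M_def by (simp add: distr_distr o_def directions_reflect)
  also have "distr ?G borel (reflect u) = ?G"
    by (rule distr_gaussian_on_orthogonal_transformation[OF sP orthogonal_transformation_reflect])
       (auto simp: mem_set_product reflect_def householder_mem[OF L u])
  finally show "distr M borel (reflect u) = M" unfolding M_def .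
qed

context rotation_invariant_frames
begin

text \<open>A Gaussian point of the intersection, seen from each of the subspaces \<open>L i\<close>.\<close>

definition meet_gauss :: "('i \<Rightarrow> (real ^ 'd) set) \<Rightarrow> real ^ 'd ^ 'd ^ 'i \<Rightarrow> real ^ 'd \<Rightarrow> real ^ 'd ^ 'i" where
  "meet_gauss L V g = (\<chi> i. pull i V *v oproj (meet L V) g)"

lemma measurable_meet_gauss [measurable (raw)]:
  assumes "\<And>i. subspace (L i)" "f \<in> borel_measurable M" "h \<in> borel_measurable M"
  shows "(\<lambda>w. meet_gauss L (f w) (h w)) \<in> borel_measurable M"
  unfolding meet_gauss_def
  using measurable_oproj_meet[OF assms] measurable_pull[OF assms(2)]
  by (intro borel_measurable_vecI) simp

lemma measure_gaussian_on_meet: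
  assumes L: "\<And>i. subspace (L i)" and [measurable]: "\<And>i. A i \<in> sets borel"
  shows "measure (gaussian_on (meet L V)) {x. \<forall>i. pull i V *v x \<in> A i}
    = measure std_gauss {g. meet_gauss L V g \<in> set_product A}"
proof -
  have K: "subspace (meet L V)" by (rule subspace_meet[OF L])
  note [measurable] = measurable_oproj[OF K]
  have "{x\<in>space borel. \<forall>i. pull i V *v x \<in> A i} \<in> sets borel" by measurable
  then have "measure (gaussian_on (meet L V)) {x. \<forall>i. pull i V *v x \<in> A i}
     = measure std_gauss (oproj (meet L V) -` {x. \<forall>i. pull i V *v x \<in> A i})"
    unfolding gaussian_on_eq[OF K] by (subst measure_distr) auto
  then show ?thesis by (simp add: vimage_def meet_gauss_def mem_set_product)
qed

lemma measurable_measure_gaussian_on_meet: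
  assumes L: "\<And>i. subspace (L i)" and A: "\<And>i. A i \<in> sets borel"
  shows "(\<lambda>V. measure (gaussian_on (meet L V)) {x. \<forall>i. pull i V *v x \<in> A i}) \<in> borel_measurable \<nu>"
proof -
  have [measurable]: "set_product A \<in> sets borel" by (rule set_product_borel[OF A])
  have "{p \<in> space (\<nu> \<Otimes>\<^sub>M std_gauss). meet_gauss L (fst p) (snd p) \<in> set_product A} \<in> sets (\<nu> \<Otimes>\<^sub>M std_gauss)"
    using measurable_meet_gauss[of L, OF L] by measurable
  from std_gauss.measurable_emeasure_Pair[OF this]
  have "(\<lambda>V. enn2real (emeasure std_gauss {g. meet_gauss L V g \<in> set_product A})) \<in> borel_measurable \<nu>"
    by (simp add: space_pair_measure vimage_def)
  then show ?thesis unfolding measure_gaussian_on_meet[OF L A] by (simp only: measure_def)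
qed

text \<open>By \<open>pull_turn\<close> and \<open>meet_turn\<close>, reflecting the components of \<open>meet_gauss\<close> amounts to turning the frames,
which preserves their law.\<close>

lemma directions_meet_gauss:
  assumes L: "\<And>i. subspace (L i)" and gen: "AE V in \<nu>. dim (meet L V) > 0"
  defines "M \<equiv> distr (\<nu> \<Otimes>\<^sub>M std_gauss) borel (\<lambda>(V, g). directions (meet_gauss L V g))"
  shows "prob_space M" "sets M = sets borel" "AE z in M. z \<in> sphere_product L"
    "(\<And>i. u i \<in> L i) \<Longrightarrow> distr M borel (reflect u) = M"
proof -
  interpret P: pair_prob_space \<nu> "std_gauss :: (real^'d) measure" ..
  note [measurable] = measurable_meet_gauss[of L, OF L]
  show "prob_space M" "sets M = sets borel" unfolding M_def by (auto intro!: P.prob_space_distr)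
  have [measurable]: "sphere_product L \<in> sets borel"
  proof -
    have [measurable]: "L i \<in> sets borel" for i using closed_subspace[OF L] by simp
    have "{z\<in>space borel. \<forall>i. (z::real^'d^'i) $ i \<in> L i \<and> norm (z $ i) = 1} \<in> sets borel" by measurable
    then show ?thesis by (simp add: sphere_product_def)
  qed
  have "AE V in \<nu>. AE g in std_gauss. directions (meet_gauss L V g) \<in> sphere_product L"
    using gen AE_pull_inj
  proof eventually_elim
    case (elim V)
    have K: "subspace (meet L V)" by (rule subspace_meet[OF L])
    have "meet L V \<noteq> {0}"
    proof
      assume "meet L V = {0}"
      then have "dim (meet L V) = 0" by simp
      then show False using elim(1) by linarith
    qed
    then obtain a where a: "a \<in> meet L V" "a \<noteq> 0" using subspace_0[OF K] by blast
    show ?case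
      using AE_std_gauss_hyperplane[OF a(2)]
    proof eventually_elim
      case g: (elim g)
      define x where "x = oproj (meet L V) g"
      have x: "x \<in> meet L V" using oproj_mem[OF K] by (simp add: x_def)
      have "a \<bullet> x \<noteq> 0" using g inner_oproj[OF K a(1)] by (simp add: x_def)
      then have "x \<noteq> 0" by auto
      then have "pull i V *v x \<noteq> 0" "pull i V *v x \<in> L i" for i
        using elim(2) x by (auto simp: meet_def)
      then show ?case
        by (simp add: sphere_product_def directions_def meet_gauss_def norm_sgn flip: x_def)
           (simp add: sgn_div_norm subspace_mul[OF L])
    qed
  qed
  then have "AE p in \<nu> \<Otimes>\<^sub>M std_gauss. directions (meet_gauss L (fst p) (snd p)) \<in> sphere_product L"
  proof (intro P.AE_pair_measure)
    have "Measurable.pred (\<nu> \<Otimes>\<^sub>M std_gauss) (\<lambda>p. directions (meet_gauss L (fst p) (snd p)) \<in> sphere_product L)"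
      by measurable
    then show "{p \<in> space (\<nu> \<Otimes>\<^sub>M std_gauss). directions (meet_gauss L (fst p) (snd p)) \<in> sphere_product L}
      \<in> sets (\<nu> \<Otimes>\<^sub>M std_gauss)" by (simp only: pred_def)
  qed simp
  then show "AE z in M. z \<in> sphere_product L"
    unfolding M_def by (subst AE_distr_iff) (auto simp: case_prod_beta)
  assume u: "\<And>i. u i \<in> L i"
  have turn: "reflect u (meet_gauss L V g) = meet_gauss L (turn u V) g" for V g
    by (simp add: reflect_def meet_gauss_def pull_turn meet_turn[OF L u])
  have [measurable]: "turn u \<in> borel_measurable borel" by measurable
  have pair: "distr (\<nu> \<Otimes>\<^sub>M std_gauss) (borel \<Otimes>\<^sub>M borel) (\<lambda>(V, g). (turn u V, g)) = \<nu> \<Otimes>\<^sub>M (std_gauss :: (real^'d) measure)"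
  proof -
    have "distr \<nu> borel (turn u) \<Otimes>\<^sub>M distr (std_gauss :: (real^'d) measure) borel (\<lambda>g. g)
      = distr (\<nu> \<Otimes>\<^sub>M std_gauss) (borel \<Otimes>\<^sub>M borel) (\<lambda>(V, g). (turn u V, g))"
      by (rule pair_measure_distr)
         (auto intro!: prob_space_imp_sigma_finite std_gauss.prob_space_distr)
    moreover have "distr (std_gauss :: (real^'d) measure) borel (\<lambda>g. g) = std_gauss"
      by (rule distr_id2) simp
    ultimately show ?thesis by (simp add: distr_turn)
  qed
  have "distr M borel (reflect u) = distr (\<nu> \<Otimes>\<^sub>M std_gauss) borel (\<lambda>(V, g). directions (meet_gauss L (turn u V) g))"
    unfolding M_def by (subst distr_distr) (auto simp: o_def split_beta' turn directions_reflect[symmetric])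
  also have "\<dots> = distr (distr (\<nu> \<Otimes>\<^sub>M std_gauss) (borel \<Otimes>\<^sub>M borel) (\<lambda>(V, g). (turn u V, g))) borel
     (\<lambda>(V, g). directions (meet_gauss L V g))"
    by (subst distr_distr) (auto simp: o_def split_beta')
  also have "\<dots> = M" unfolding pair M_def ..
  finally show "distr M borel (reflect u) = M" .
qed

text \<open>By Fubini, the left-hand side is the probability that a Gaussian point of the random intersection is
seen in \<open>A i\<close> from each \<open>L i\<close>. It is determined by the law of the directions, which is the same on
both sides by invariance under reflections.\<close>

lemma average_gaussian_meet:
  assumes L: "\<And>i. subspace (L i)" and A: "\<And>i. A i \<in> sets borel"
    and conic: "\<And>i c x. 0 < c \<Longrightarrow> x \<in> A i \<Longrightarrow> c *\<^sub>R x \<in> A i"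
    and dim: "(\<Sum>i\<in>UNIV. dim (L i)) > (CARD('i) - 1) * CARD('d)"
  shows "(\<integral>V. measure (gaussian_on (meet L V)) {x. \<forall>i. pull i V *v x \<in> A i} \<partial>\<nu>)
    = measure (gaussian_on (set_product L)) (set_product A)"
proof -
  interpret P: pair_prob_space \<nu> "std_gauss :: (real^'d) measure" ..
  have sP: "subspace (set_product L)" by (rule subspace_set_product[OF L])
  have mA [measurable]: "set_product A \<in> sets borel" by (rule set_product_borel[OF A])
  have gen: "AE V in \<nu>. dim (meet L V) > 0"
    using AE_dim_meet[of L, OF L] by eventually_elim (use dim in simp)
  \<comment> \<open>The other subspaces account for at most (CARD('i) - 1) * CARD('d) of the sum of dimensions.\<close>
  have nz: "L i \<noteq> {0}" for i
  proof
    assume Li: "L i = {0}"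
    have "(\<Sum>i\<in>UNIV. dim (L i)) = dim (L i) + (\<Sum>i\<in>UNIV - {i}. dim (L i))" by (rule sum.remove) auto
    also have "(\<Sum>i\<in>UNIV - {i}. dim (L i)) \<le> (\<Sum>i\<in>UNIV - {i}. CARD('d))"
      by (intro sum_mono) (metis DIM_cart DIM_real dim_subset_UNIV mult.right_neutral)
    finally show False using dim Li by (simp add: card_Diff_singleton)
  qed
  let ?Y = "\<lambda>(V, g). directions (meet_gauss L V g)"
  have Ym [measurable]: "?Y \<in> borel_measurable (\<nu> \<Otimes>\<^sub>M std_gauss)"
    using measurable_meet_gauss[of L, OF L] by measurable
  have eq: "distr (\<nu> \<Otimes>\<^sub>M std_gauss) borel ?Y = distr (gaussian_on (set_product L)) borel directions"
    by (rule measure_eq_of_reflection_invariant[OF L directions_meet_gauss[of L, OF L gen] directions_gaussian[of L, OF L nz]])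
  have "emeasure (gaussian_on (set_product L)) (set_product A)
     = emeasure (distr (gaussian_on (set_product L)) borel directions) (set_product A)"
  proof -
    have "directions -` set_product A \<inter> space (gaussian_on (set_product L)) = set_product A"
      using sets_eq_imp_space_eq[OF sets_gaussian_on[OF sP]] by (auto simp: directions_mem_set_product[of A, OF conic])
    then show ?thesis
      using measurable_directions sets_gaussian_on[OF sP]
      by (subst emeasure_distr) (auto cong: measurable_cong_sets)
  qed
  also have "\<dots> = emeasure (\<nu> \<Otimes>\<^sub>M std_gauss) (?Y -` set_product A \<inter> space (\<nu> \<Otimes>\<^sub>M std_gauss))"
    unfolding eq[symmetric] by (rule emeasure_distr[OF Ym mA])
  also have "\<dots> = (\<integral>\<^sup>+V. emeasure std_gauss {g. meet_gauss L V g \<in> set_product A} \<partial>\<nu>)"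
  proof (subst std_gauss.emeasure_pair_measure_alt)
    show "?Y -` set_product A \<inter> space (\<nu> \<Otimes>\<^sub>M std_gauss) \<in> sets (\<nu> \<Otimes>\<^sub>M std_gauss)"
      by (rule measurable_sets[OF Ym mA])
    have "Pair V -` (?Y -` set_product A \<inter> space (\<nu> \<Otimes>\<^sub>M std_gauss)) = {g. meet_gauss L V g \<in> set_product A}" for V
      by (auto simp: space_pair_measure directions_mem_set_product[of A, OF conic])
    then show "(\<integral>\<^sup>+V. emeasure std_gauss (Pair V -` (?Y -` set_product A \<inter> space (\<nu> \<Otimes>\<^sub>M std_gauss))) \<partial>\<nu>)
      = (\<integral>\<^sup>+V. emeasure std_gauss {g. meet_gauss L V g \<in> set_product A} \<partial>\<nu>)" by (simp only:)
  qed
  also have "\<dots> = (\<integral>\<^sup>+V. ennreal (measure (gaussian_on (meet L V)) {x. \<forall>i. pull i V *v x \<in> A i}) \<partial>\<nu>)"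
    by (simp add: measure_gaussian_on_meet[OF L A] std_gauss.emeasure_eq_measure)
  finally have "emeasure (gaussian_on (set_product L)) (set_product A)
     = (\<integral>\<^sup>+V. ennreal (measure (gaussian_on (meet L V)) {x. \<forall>i. pull i V *v x \<in> A i}) \<partial>\<nu>)" .
  then show ?thesis
    using measurable_measure_gaussian_on_meet[of L A, OF L A]
    by (subst integral_eq_nn_integral) (auto simp: measure_def)
qed

end

section \<open>The kinematic formula\<close>

lemma polyhedral_measure_set_product:
  fixes C M :: "'i::finite \<Rightarrow> 'a::euclidean_space set"
  assumes C: "\<And>i. polyhedral_cone (C i)" and M: "\<And>i. M i \<in> sets borel"
  shows "polyhedral_measure m (set_product C) (set_product M) =
    (\<Sum>L\<in>{L\<in>lineality_tuples C. (\<Sum>i\<in>UNIV. dim (L i)) = m}.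
       measure (gaussian_on (set_product L)) (set_product (\<lambda>i. stratum (C i) (L i) \<inter> M i)))"
proof -
  have lin: "linear (\<lambda>x::'a^'i. x $ i)" for i by (simp add: linear_iff)
  have "{L\<in>lineality_tuples C. dim (set_product L) = m} = {L\<in>lineality_tuples C. (\<Sum>i\<in>UNIV. dim (L i)) = m}"
  proof -
    have "dim (set_product L) = (\<Sum>i\<in>UNIV. dim (L i))" if "L \<in> lineality_tuples C" for L
      using subspace_lineality_tuples[of C L, OF C that] by (rule dim_set_product)
    then show ?thesis by auto
  qed
  then show ?thesis
    using polyhedral_measure_vimage[of "\<lambda>i x. x $ i" C M m, OF lin C M] by (simp add: set_product_def)
qed

lemma finite_compositions: "finite {j :: 'i::finite \<Rightarrow> nat. (\<Sum>i\<in>UNIV. j i) = m}"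
proof (rule finite_subset)
  show "{j :: 'i \<Rightarrow> nat. (\<Sum>i\<in>UNIV. j i) = m} \<subseteq> PiE UNIV (\<lambda>_. {..m})"
    by (auto simp: PiE_def intro: member_le_sum)
qed (simp add: finite_PiE)

text \<open>Group the tuples of spans by their dimensions \<open>j\<close>; for each \<open>j\<close> the sum over tuples factorises.\<close>

lemma polyhedral_measure_set_product_convolution:
  fixes C M :: "'i::finite \<Rightarrow> 'a::euclidean_space set"
  assumes C: "\<And>i. polyhedral_cone (C i)" and M: "\<And>i. M i \<in> sets borel"
  shows "polyhedral_measure m (set_product C) (set_product M)
    = (\<Sum>j | (\<Sum>i\<in>UNIV. j i) = m. \<Prod>i\<in>UNIV. polyhedral_measure (j i) (C i) (M i))"
proof -
  define h where "h L = (\<Prod>i\<in>UNIV. measure (gaussian_on (L i)) (stratum (C i) (L i) \<inter> M i))" for L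
  let ?T = "{L\<in>lineality_tuples C. (\<Sum>i\<in>UNIV. dim (L i)) = m}"
  have fin: "finite ?T" using finite_lineality_tuples[of C, OF C] by simp
  have "polyhedral_measure m (set_product C) (set_product M) = (\<Sum>L\<in>?T. h L)"
    unfolding polyhedral_measure_set_product[OF C M] h_def
  proof (intro sum.cong refl measure_gaussian_on_set_product)
    fix L i assume L: "L \<in> ?T"
    then show "subspace (L i)" using subspace_lineality_tuples[of C L, OF C] by blast
    show "stratum (C i) (L i) \<inter> M i \<in> sets borel"
      using L stratum_borel[OF C, of "L i" i] M by (auto simp: lineality_tuples_def)
  qed
  also have "\<dots> = (\<Sum>j | (\<Sum>i\<in>UNIV. j i) = m. \<Sum>L\<in>{L\<in>?T. (\<lambda>i. dim (L i)) = j}. h L)"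
    by (rule sum.group[symmetric, OF fin finite_compositions]) auto
  also have "\<dots> = (\<Sum>j | (\<Sum>i\<in>UNIV. j i) = m. \<Prod>i\<in>UNIV. polyhedral_measure (j i) (C i) (M i))"
  proof (rule sum.cong[OF refl])
    fix j :: "'i \<Rightarrow> nat" assume "j \<in> {j. (\<Sum>i\<in>UNIV. j i) = m}"
    then have T: "{L\<in>?T. (\<lambda>i. dim (L i)) = j} = PiE UNIV (\<lambda>i. {L \<in> lineality (C i) ` C i. dim L = j i})"
      by (auto simp: lineality_tuples_def PiE_def Pi_def fun_eq_iff)
    have "(\<Prod>i\<in>UNIV. polyhedral_measure (j i) (C i) (M i))
      = (\<Prod>i\<in>UNIV. \<Sum>L\<in>{L \<in> lineality (C i) ` C i. dim L = j i}. measure (gaussian_on L) (stratum (C i) L \<inter> M i))"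
      by (intro prod.cong refl polyhedral_measure_eq_strata C M)
    also have "\<dots> = (\<Sum>L\<in>{L\<in>?T. (\<lambda>i. dim (L i)) = j}. h L)"
      unfolding T h_def using finite_lineality[OF C] by (intro prod_sum_PiE) auto
    finally show "(\<Sum>L\<in>{L\<in>?T. (\<lambda>i. dim (L i)) = j}. h L)
      = (\<Prod>i\<in>UNIV. polyhedral_measure (j i) (C i) (M i))" ..
  qed
  finally show ?thesis .
qed

context rotation_invariant_frames
begin

text \<open>Each tuple \<open>L\<close> contributes only if its intersection has dimension \<open>k\<close>. Since \<open>k > 0\<close>, this almost
surely happens if and only if the dimensions of the \<open>L i\<close> add up to \<open>n d + k\<close>; for \<open>k = 0\<close>, tuples with
smaller sums would contribute as well.\<close>

lemma polyhedral_measure_meet_average: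
  assumes C: "\<And>i. polyhedral_cone (C i)" and M: "\<And>i. M i \<in> conic_borel" and k: "0 < k"
  defines "F \<equiv> \<lambda>V. polyhedral_measure k {x. \<forall>i. pull i V *v x \<in> C i} {x. \<forall>i. pull i V *v x \<in> M i}"
  shows "F \<in> borel_measurable \<nu>" "integrable \<nu> F"
    "integral\<^sup>L \<nu> F = polyhedral_measure ((CARD('i) - 1) * CARD('d) + k) (set_product C) (set_product M)"
proof -
  let ?T = "lineality_tuples C"
  have Mb: "M i \<in> sets borel" for i using M by (auto simp: conic_borel_def)
  define A where "A L i = stratum (C i) (L i) \<inter> M i" for L i
  have L: "subspace (L i)" if "L \<in> ?T" for L i using subspace_lineality_tuples[of C L, OF C that] .
  have Lin: "L i \<in> lineality (C i) ` C i" if "L \<in> ?T" for L i using that by (simp add: lineality_tuples_def)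
  have Ab: "A L i \<in> sets borel" if "L \<in> ?T" for L i
    using stratum_borel[OF C Lin[OF that]] Mb by (auto simp: A_def)
  have conic: "c *\<^sub>R x \<in> A L i" if "L \<in> ?T" "0 < c" "x \<in> A L i" for L i c x
  proof -
    have "(\<lambda>x. c *\<^sub>R x) ` M i = M i" using M[of i] that(2) by (simp add: conic_borel_def)
    then have "c *\<^sub>R x \<in> M i" using that(3) unfolding A_def by blast
    then show ?thesis using stratum_conic[OF C Lin[OF that(1)] that(2)] that(3) by (simp add: A_def)
  qed
  have fin: "finite ?T" by (rule finite_lineality_tuples[of C, OF C])
  define G where "G L V = (if dim (meet L V) = k
      then measure (gaussian_on (meet L V)) {x. \<forall>i. pull i V *v x \<in> A L i} else 0)" for L V
  have F: "F V = (\<Sum>L\<in>?T. G L V)" for V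
    unfolding F_def G_def using fin
    by (subst polyhedral_measure_vimage[OF linear_matrix_vector_mult C Mb])
       (simp add: meet_def A_def sum.inter_filter[symmetric])
  have Gm: "G L \<in> borel_measurable \<nu>" if "L \<in> ?T" for L
  proof -
    have d: "(\<lambda>V. real (dim (meet L V))) \<in> borel_measurable \<nu>" by (rule measurable_dim_meet[of L, OF L[OF that]]) simp
    have "Measurable.pred \<nu> (\<lambda>V. real (dim (meet L V)) = real k)" using d by measurable
    then have "Measurable.pred \<nu> (\<lambda>V. dim (meet L V) = k)" by simp
    then show ?thesis
      unfolding G_def[abs_def] using measurable_measure_gaussian_on_meet[of L "A L", OF L[OF that] Ab[OF that]]
      by (intro measurable_If) (auto simp: pred_def)
  qed
  have Gb: "norm (G L V) \<le> 1" if "L \<in> ?T" for L V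
    using prob_space.prob_le_1[OF prob_space_gaussian_on[OF subspace_meet[of L V, OF L[OF that]]]] by (simp add: G_def)
  have Gi: "integrable \<nu> (G L)" if "L \<in> ?T" for L
    by (rule integrable_const_bound[of _ 1]) (use Gm[OF that] Gb[OF that] in auto)
  show "F \<in> borel_measurable \<nu>" unfolding F[abs_def] using Gm by (intro borel_measurable_sum)
  show "integrable \<nu> F" unfolding F[abs_def] using Gi by (intro Bochner_Integration.integrable_sum)
  let ?N = "(CARD('i) - 1) * CARD('d)"
  have IG: "integral\<^sup>L \<nu> (G L) = (if (\<Sum>i\<in>UNIV. dim (L i)) = ?N + k
      then measure (gaussian_on (set_product L)) (set_product (A L)) else 0)" if LT: "L \<in> ?T" for L
  proof (cases "(\<Sum>i\<in>UNIV. dim (L i)) = ?N + k")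
    case True
    then have gt: "(\<Sum>i\<in>UNIV. dim (L i)) > ?N" using k by simp
    have "integral\<^sup>L \<nu> (G L) = (\<integral>V. measure (gaussian_on (meet L V)) {x. \<forall>i. pull i V *v x \<in> A L i} \<partial>\<nu>)"
    proof (rule integral_cong_AE[OF Gm[OF LT] measurable_measure_gaussian_on_meet[OF L[OF LT] Ab[OF LT]]])
      show "AE V in \<nu>. G L V = measure (gaussian_on (meet L V)) {x. \<forall>i. pull i V *v x \<in> A L i}"
        using AE_dim_meet[of L, OF L[OF LT]] by eventually_elim (simp add: G_def True)
    qed
    also have "\<dots> = measure (gaussian_on (set_product L)) (set_product (A L))"
      by (rule average_gaussian_meet[OF L[OF LT] Ab[OF LT] conic[OF LT] gt])
    finally show ?thesis using True by simp
  next
    case False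
    have "AE V in \<nu>. G L V = 0"
      using AE_dim_meet[of L, OF L[OF LT]] by eventually_elim (use False k in \<open>auto simp: G_def\<close>)
    then have "integral\<^sup>L \<nu> (G L) = 0" by (rule integral_eq_zero_AE)
    then show ?thesis using False by simp
  qed
  have "integral\<^sup>L \<nu> F = (\<Sum>L\<in>?T. integral\<^sup>L \<nu> (G L))"
    unfolding F[abs_def] using Gi by (intro Bochner_Integration.integral_sum)
  also have "\<dots> = (\<Sum>L\<in>?T. if (\<Sum>i\<in>UNIV. dim (L i)) = ?N + k
      then measure (gaussian_on (set_product L)) (set_product (A L)) else 0)"
    by (intro sum.cong refl IG)
  also have "\<dots> = polyhedral_measure (?N + k) (set_product C) (set_product M)"
    unfolding polyhedral_measure_set_product[OF C Mb] A_def[abs_def] by (rule sum.inter_filter[OF fin, symmetric])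
  finally show "integral\<^sup>L \<nu> F = polyhedral_measure (?N + k) (set_product C) (set_product M)" .
qed

end

theorem theorem2p9:
  fixes n k :: nat
    and C M :: "'i::finite \<Rightarrow> (real ^ 'd) set"
    and T :: "'i \<Rightarrow> real ^ 'd ^ 'd"
    and P :: "'w measure"
    and Q :: "'i \<Rightarrow> 'w \<Rightarrow> real ^ 'd ^ 'd"
  assumes "CARD('i) = n + 1"
    and "\<And>i. polyhedral_cone (C i)"
    and "\<And>i. M i \<in> conic_borel"
    and "\<And>i. invertible (T i)"
    and "prob_space P"
    and "prob_space.indep_vars P (\<lambda>_. orthogonal_borel) Q UNIV"
    and "\<And>i. haar_orthogonal (distr P orthogonal_borel (Q i))"
    and "0 < k" and "k \<le> CARD('d)"
  shows "integrable P (\<lambda>\<omega>. polyhedral_measure k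
             (\<Inter>i. (\<lambda>x. T i *v (Q i \<omega> *v x)) ` C i) (\<Inter>i. (\<lambda>x. T i *v (Q i \<omega> *v x)) ` M i)) \<and>
         (LINT \<omega>|P. polyhedral_measure k
             (\<Inter>i. (\<lambda>x. T i *v (Q i \<omega> *v x)) ` C i) (\<Inter>i. (\<lambda>x. T i *v (Q i \<omega> *v x)) ` M i))
           = polyhedral_measure (n * CARD('d) + k) (set_product C) (set_product M) \<and>
         (\<forall>m. polyhedral_measure m (set_product C) (set_product M)
           = (\<Sum>j | (\<Sum>i\<in>UNIV. j i) = m. \<Prod>i\<in>UNIV. polyhedral_measure (j i) (C i) (M i)))"
proof -
  interpret P: prob_space P by fact
  define S where "S i = (SOME S. S ** T i = mat 1 \<and> T i ** S = mat 1)" for i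
  have S: "S i ** T i = mat 1" "T i ** S i = mat 1" for i
  proof -
    have "\<exists>S. S ** T i = mat 1 \<and> T i ** S = mat 1" using assms(4)[of i] unfolding invertible_def by blast
    from someI_ex[OF this] show "S i ** T i = mat 1" "T i ** S i = mat 1" unfolding S_def by blast+
  qed
  have Q: "Q i \<in> measurable P orthogonal_borel" for i using assms(6) by (auto simp: P.indep_vars_def)
  then have Qb [measurable]: "Q i \<in> borel_measurable P" and Qo: "\<And>\<omega>. \<omega> \<in> space P \<Longrightarrow> orthogonal_matrix (Q i \<omega>)" for i
    unfolding orthogonal_borel_def by (auto simp: measurable_restrict_space2_iff)
  define V where "V \<omega> = (\<chi> i. Q i \<omega>)" for \<omega>
  have V [measurable]: "V \<in> borel_measurable P" unfolding V_def by (intro borel_measurable_vecI) simp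
  define \<nu> where "\<nu> = distr P borel V"
  have "prob_space \<nu>" unfolding \<nu>_def by (rule P.prob_space_distr) simp
  then interpret F: rotation_invariant_frames \<nu> S
  proof (intro rotation_invariant_frames.intro rotation_invariant_frames_axioms.intro)
    show "sets \<nu> = sets borel" by (simp add: \<nu>_def)
    have [measurable]: "Measurable.pred borel (\<lambda>V :: real^'d^'d^'i. \<forall>i. orthogonal_matrix (V $ i))"
    proof -
      have "Measurable.pred borel (\<lambda>V :: real^'d^'d^'i. \<forall>i. transpose (V $ i) ** V $ i = mat 1)" by measurable
      then show ?thesis by (simp add: orthogonal_matrix)
    qed
    show "AE V in \<nu>. \<forall>i. orthogonal_matrix (V $ i)"
      unfolding \<nu>_def by (subst AE_distr_iff) (auto simp: V_def Qo)
    show "distr \<nu> borel (\<lambda>V. \<chi> i. V $ i ** R i) = \<nu>" if R: "\<And>i. orthogonal_matrix (R i)" for R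
    proof -
      have "(\<lambda>V :: real^'d^'d^'i. \<chi> i. V $ i ** R i) \<in> borel_measurable borel"
        by (rule borel_measurable_vecI) simp
      then have "distr \<nu> borel (\<lambda>V. \<chi> i. V $ i ** R i) = distr P borel (\<lambda>\<omega>. \<chi> i. Q i \<omega> ** R i)"
        unfolding \<nu>_def by (subst distr_distr) (auto simp: o_def V_def)
      also have "\<dots> = \<nu>"
        unfolding \<nu>_def V_def[abs_def] by (rule joint_haar_right_invariant[OF assms(5,6,7) R])
      finally show ?thesis .
    qed
    show "invertible (S i)" for i using S unfolding invertible_def by blast
  qed
  have img: "(\<Inter>i. (\<lambda>x. T i *v (Q i \<omega> *v x)) ` X i) = {x. \<forall>i. F.pull i (V \<omega>) *v x \<in> X i}"
    if \<omega>: "\<omega> \<in> space P" for X :: "'i \<Rightarrow> (real^'d) set" and \<omega>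
  proof -
    note o = orthogonal_matrix_inverses[OF Qo[OF \<omega>]]
    have a: "T i *v (Q i \<omega> *v (F.pull i (V \<omega>) *v x)) = x" for i x
    proof -
      have "T i *v (Q i \<omega> *v (F.pull i (V \<omega>) *v x)) = (T i ** (Q i \<omega> ** transpose (Q i \<omega>)) ** S i) *v x"
        by (simp add: F.pull_def V_def matrix_vector_mul_assoc matrix_mul_assoc del: transpose_matrix_vector)
      then show ?thesis by (simp add: o S)
    qed
    have b: "F.pull i (V \<omega>) *v (T i *v (Q i \<omega> *v x)) = x" for i x
    proof -
      have "F.pull i (V \<omega>) *v (T i *v (Q i \<omega> *v x)) = (transpose (Q i \<omega>) ** (S i ** T i) ** Q i \<omega>) *v x"
        by (simp add: F.pull_def V_def matrix_vector_mul_assoc matrix_mul_assoc del: transpose_matrix_vector)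
      then show ?thesis by (simp add: o S)
    qed
    have "y \<in> (\<lambda>x. T i *v (Q i \<omega> *v x)) ` X i \<longleftrightarrow> F.pull i (V \<omega>) *v y \<in> X i" for i y
    proof
      assume "y \<in> (\<lambda>x. T i *v (Q i \<omega> *v x)) ` X i"
      then obtain x where "x \<in> X i" "y = T i *v (Q i \<omega> *v x)" by blast
      then show "F.pull i (V \<omega>) *v y \<in> X i" by (simp only: b)
    next
      assume "F.pull i (V \<omega>) *v y \<in> X i"
      then show "y \<in> (\<lambda>x. T i *v (Q i \<omega> *v x)) ` X i" by (rule image_eqI[rotated]) (rule a[symmetric])
    qed
    then show ?thesis by blast
  qed
  define \<Psi> where "\<Psi> U = polyhedral_measure k {x. \<forall>i. F.pull i U *v x \<in> C i} {x. \<forall>i. F.pull i U *v x \<in> M i}" for U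
  note avg = F.polyhedral_measure_meet_average[of C M k, OF assms(2,3,8), folded \<Psi>_def[abs_def]]
  have \<Psi>m: "\<Psi> \<in> borel_measurable borel" using avg(1) by (simp cong: measurable_cong_sets)
  have eq: "polyhedral_measure k (\<Inter>i. (\<lambda>x. T i *v (Q i \<omega> *v x)) ` C i) (\<Inter>i. (\<lambda>x. T i *v (Q i \<omega> *v x)) ` M i)
    = \<Psi> (V \<omega>)" if "\<omega> \<in> space P" for \<omega>
    unfolding \<Psi>_def img[OF that] ..
  have int: "integrable P (\<lambda>\<omega>. \<Psi> (V \<omega>))"
    using avg(2) unfolding \<nu>_def by (subst (asm) integrable_distr_eq[OF V \<Psi>m])
  have val: "(LINT \<omega>|P. \<Psi> (V \<omega>)) = polyhedral_measure (n * CARD('d) + k) (set_product C) (set_product M)"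
    using avg(3) assms(1) unfolding \<nu>_def by (subst (asm) integral_distr[OF V \<Psi>m]) simp
  have Mb: "M i \<in> sets borel" for i using assms(3) by (auto simp: conic_borel_def)
  show ?thesis
  proof (intro conjI allI)
    show "integrable P (\<lambda>\<omega>. polyhedral_measure k
             (\<Inter>i. (\<lambda>x. T i *v (Q i \<omega> *v x)) ` C i) (\<Inter>i. (\<lambda>x. T i *v (Q i \<omega> *v x)) ` M i))"
      by (rule Bochner_Integration.integrable_cong[THEN iffD2, OF refl _ int]) (rule eq)
    show "(LINT \<omega>|P. polyhedral_measure k
             (\<Inter>i. (\<lambda>x. T i *v (Q i \<omega> *v x)) ` C i) (\<Inter>i. (\<lambda>x. T i *v (Q i \<omega> *v x)) ` M i))
           = polyhedral_measure (n * CARD('d) + k) (set_product C) (set_product M)"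
      by (rule trans[OF Bochner_Integration.integral_cong[OF refl] val]) (rule eq)
    show "polyhedral_measure m (set_product C) (set_product M)
       = (\<Sum>j | (\<Sum>i\<in>UNIV. j i) = m. \<Prod>i\<in>UNIV. polyhedral_measure (j i) (C i) (M i))" for m
      by (rule polyhedral_measure_set_product_convolution[OF assms(2) Mb])
  qed
qed

end
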